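(* Let $\mathsf n\ge 2$ be an integer, let $(\mathfrak A,\mathfrak B)$ be an access structure on $[\mathsf n]$ with $\mathfrak A\neq\emptyset$, let $\mathbb F_q$ be a finite field, let $\mathsf x,\mathsf y,\mathsf z$ be positive integers, and let $\tau:[\mathsf z]\to[\mathsf n]$ be a map. The following conditions are equivalent. (a) For some $\mathsf f\ge 2$, there exists a linear $(\mathfrak A,\mathfrak B,\mathsf n,\mathsf f)$-CSSPIR protocol over $\mathbb F_q$ with position map $\tau$, PIR rate $\mathsf x/\mathsf z$ and shared randomness rate $\mathsf y/\mathsf x$. (b) There exists a linear $(\mathfrak A,\mathfrak B,\mathsf n)$-CSNSS protocol over $\mathbb F_q$ with position map $\tau$, SS rate $\mathsf x/\mathsf z$ and randomness rate $\mathsf y/\mathsf x$. (c) There exists an $(\mathfrak A,\mathfrak B,\mathsf n)$-MMSP with a matrix $\mathsf G\in\mathbb F_q^{\mathsf z\times(\mathsf x+\mathsf y)}$ and position map $\tau$ (so its rate is $\mathsf x/\mathsf z$). (d) For every $\mathsf f\ge 2$, there exists a projected linear $(\mathfrak A,\mathfrak B,\mathsf n,\mathsf f)$-CSSPIR protocol over $\mathbb F_q$ with position map $\tau$, PIR rate $\mathsf x/\mathsf z$ and shared randomness rate $\mathsf y/\mathsf x$.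
   Context: Notation: $[n]=\{1,\dots,n\}$. For a tuple $A=(A_1,\dots,A_n)$ and $\mathcal X\subset[n]$, $A_{\mathcal X}=(A_i)_{i\in\mathcal X}$; for a matrix $\mathsf A$ with rows indexed by $[n]$, $\mathsf A_{\mathcal X}$ is the submatrix of rows indexed by $\mathcal X$. $I(\cdot;\cdot)$ is mutual information. Access structure on $[\mathsf n]$: a pair $(\mathfrak A,\mathfrak B)$ of subsets of $2^{[\mathsf n]}$ with $\mathfrak A$ closed under supersets, $\mathfrak B$ closed under subsets, and $\mathfrak A\cap\mathfrak B=\emptyset$. SPIR protocol ($\mathsf n$ servers, $\mathsf f$ files). Data: finite sets $\mathcal M$ (files), $\mathcal U$ (random seeds), $\mathcal R$ (user randomness), $\mathcal T_j,\mathcal Q_j,\mathcal D_j$ ($j\in[\mathsf n]$), and deterministic maps $h:\mathcal U\to\prod_j\mathcal T_j$, $\phi:[\mathsf f]\times\mathcal R\to\prod_j\mathcal Q_j$, $g_j:\mathcal Q_j\times\mathcal M^{\mathsf f}\times\mathcal T_j\to\mathcal D_j$. The random variables $M=(M_1,\dots,M_{\mathsf f})\in\mathcal M^{\mathsf f}$, $U\in\mathcal U$, $K\in[\mathsf f]$, $R\in\mathcal R$ are uniform and mutually independent; $T=h(U)$, $Q=\phi(K,R)$, $D_j=g_j(Q_j,M,T_j)$, $D=(D_1,\dots,D_{\mathsf n})$. It is an $(\mathfrak A,\mathfrak B,\mathsf n,\mathsf f)$-CSSPIR protocol (completely secure SPIR) if: - Correctness: for all $r\in\mathcal R$, $k\in[\mathsf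 f]$, $\mathcal A\in\mathfrak A$, given $K=k,R=r$ the maximum likelihood decoder of $M_k$ from $D_{\mathcal A}$ has error probability $0$ (i.e. $M_k$ is a function of $D_{\mathcal A}$). - Server secrecy: $I(D;M_{[\mathsf f]\setminus\{k\}}\mid R=r,K=k)=0$ for all $r,k$. - User secrecy: $I(K;Q_{\mathcal B})=0$ for all $\mathcal B\in\mathfrak B$. The PIR rate is $\log|\mathcal M|/\sum_j\log|\mathcal D_j|$; the shared randomness rate is $\log|\mathcal U|/\log|\mathcal M|$. Linear SPIR over $\mathbb F_q$ with position map $\tau:[\mathsf z]\to[\mathsf n]$: a SPIR protocol in which $\mathcal M=\mathbb F_q^{\mathsf x}$, $M\in\mathbb F_q^{\mathsf f\mathsf x}$ is the concatenation of the files, $\mathcal U=\mathbb F_q^{\mathsf y}$, $T=\mathsf H U$ for a matrix $\mathsf H\in\mathbb F_q^{\mathsf z\times\mathsf y}$ with $T_j=\mathsf H_{\tau^{-1}(j)}U$, the full query is a matrix $Q\in\mathbb F_q^{\mathsf z\times\mathsf f\mathsf x}$ (a function of $(K,R)$) of which server $j$ receives the rows $Q_{\tau^{-1}(j)}$, and $D_j=Q_{\tau^{-1}(j)}M+T_j\in\mathbb F_q^{|\tau^{-1}(j)|}$. Its PIR rate is $\mathsf x/\mathsf z$ and its shared randomness rate is $\mathsf y/\mathsf x$. Projected linear SPIR: a linear SPIR protocol in which $R$ is a uniform matrix in $\mathbb F_q^{\mathsf y\times\mathsf f\mathsf x}$ and, for $K=k$, $Q=\mathsf J\mathsf E_k+\mathsf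 H R$, where $\mathsf J\in\mathbb F_q^{\mathsf z\times\mathsf x}$ is a fixed matrix, $\mathsf E_k\in\mathbb F_q^{\mathsf x\times\mathsf f\mathsf x}$ has $k$-th $\mathsf x\times\mathsf x$ block equal to the identity and all other blocks zero, and $\mathsf H$ is the shared-randomness matrix. NSS protocol ($\mathsf n$ players): finite sets $\mathcal M$ (secrets), $\mathcal U$, $\mathcal S_1,\dots,\mathcal S_{\mathsf n}$ and a map $\psi:\mathcal M\times\mathcal U\to\prod_j\mathcal S_j$; $L\in\mathcal M$ and $U\in\mathcal U$ are independent and uniform, and the shares are $(S_1,\dots,S_{\mathsf n})=\psi(L,U)$. It is an $(\mathfrak A,\mathfrak B,\mathsf n)$-CSNSS protocol (completely secure) if for every $\mathcal A\in\mathfrak A$ the maximum likelihood decoder of $L$ from $S_{\mathcal A}$ has error probability $0$, and $I(L;S_{\mathcal B})=0$ for every $\mathcal B\in\mathfrak B$. The SS rate is $\log|\mathcal M|/\sum_j\log|\mathcal S_j|$; the randomness rate is $\log|\mathcal U|/\log|\mathcal M|$. Linear NSS over $\mathbb F_q$ with position map $\tau:[\mathsf z]\to[\mathsf n]$: $\mathcal M=\mathbb F_q^{\mathsf x}$, $\mathcal U=\mathbb F_q^{\mathsf y}$, and there is a linear map $\psi:\mathbb F_q^{\mathsf x+\mathsf y}\to\mathbb F_q^{\mathsf z}$ such that, with $(Z_1,\dots,Z_{\mathsf z})=\psi(L,U)$, $S_j=(Z_i)_{i\in\tau^{-1}(j)}\in\mathbb F_q^{|\tau^{-1}(j)|}$.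 Its SS rate is $\mathsf x/\mathsf z$ and its randomness rate is $\mathsf y/\mathsf x$. MMSP (multi-target monotone span program): a pair $(\mathsf G,\tau)$ with $\mathsf G\in\mathbb F_q^{\mathsf z\times(\mathsf x+\mathsf y)}$ and $\tau:[\mathsf z]\to[\mathsf n]$. Let $\mathcal E=\{\mathbf e_1,\dots,\mathbf e_{\mathsf x}\}$ be the first $\mathsf x$ standard basis row vectors of $\mathbb F_q^{\mathsf x+\mathsf y}$. It is an $(\mathfrak A,\mathfrak B,\mathsf n)$-MMSP if $\mathcal E\subset\operatorname{rowspan}\mathsf G_{\tau^{-1}(\mathcal A)}$ for all $\mathcal A\in\mathfrak A$ (it accepts $\mathfrak A$), and $\operatorname{span}\mathcal E\cap\operatorname{rowspan}\mathsf G_{\tau^{-1}(\mathcal B)}=\{0\}$ for all $\mathcal B\in\mathfrak B$ (it rejects $\mathfrak B$). Its rate is $\mathsf x/\mathsf z$. In (a), (b), (d), the parameters of the linear protocols are understood to be the given $\mathsf x,\mathsf y,\mathsf z$ (with $\tau$ fixed, the rates determine them). *)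

theory Defs
  imports
    "HOL-Probability.Information"
    "Jordan_Normal_Form.VS_Connect"
    "Jordan_Normal_Form.DL_Submatrix"
begin

text \<open>Vectors and matrices are those of \<^theory>\<open>Jordan_Normal_Form.Matrix\<close>.\<close>

hide_type (open) Finite_Cartesian_Product.vec
hide_const (open) Finite_Cartesian_Product.vec Finite_Cartesian_Product.mat
no_notation Finite_Cartesian_Product.vec_nth (infixl \<open>$\<close> 90)

text \<open>
  Index sets are zero-based throughout: servers and players are \<open>{..<n}\<close>, files are \<open>{..<f}\<close>,
  matrix rows are \<open>{..<z}\<close>. A tuple indexed by a set \<open>X\<close> is a function restricted to \<open>X\<close>.
\<close>

definition access_structure :: "nat \<Rightarrow> nat set set \<Rightarrow> nat set set \<Rightarrow> bool" where
  "access_structure n \<AA> \<BB> \<longleftrightarrow>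
     \<AA> \<subseteq> Pow {..<n} \<and> \<BB> \<subseteq> Pow {..<n} \<and>
     (\<forall>A\<in>\<AA>. \<forall>C. A \<subseteq> C \<and> C \<subseteq> {..<n} \<longrightarrow> C \<in> \<AA>) \<and>
     (\<forall>B\<in>\<BB>. \<forall>C. C \<subseteq> B \<longrightarrow> C \<in> \<BB>) \<and>
     \<AA> \<inter> \<BB> = {}"


section \<open>Information and decoding on a discrete probability space\<close>

text \<open>
  This is \<open>\<I>(X ; Y)\<close> of the locale \<^locale>\<open>information_space\<close> in base 2,
  spelt out so that the probability space can be an argument.
\<close>

definition mutual_info :: "'o measure \<Rightarrow> ('o \<Rightarrow> 'a) \<Rightarrow> ('o \<Rightarrow> 'b) \<Rightarrow> real" where
  "mutual_info P X Y =
     prob_space.mutual_information P 2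
       (count_space (X ` space P)) (count_space (Y ` space P)) X Y"

text \<open>
  The maximum likelihood decoder of \<open>X\<close>, ranging over the alphabet \<open>C\<close>, from an observation of \<open>Y\<close>.
  Ties are broken arbitrarily, by \<^const>\<open>arg_max_on\<close>; for \<open>X\<close> uniform on \<open>C\<close> this does not affect
  the error probability.
\<close>

definition ml_decoder ::
    "'o measure \<Rightarrow> 'a set \<Rightarrow> ('o \<Rightarrow> 'a) \<Rightarrow> ('o \<Rightarrow> 'b) \<Rightarrow> 'b \<Rightarrow> 'a" where
  "ml_decoder P C X Y y = arg_max_on (\<lambda>x. \<P>(\<omega> in P. Y \<omega> = y \<bar> X \<omega> = x)) C"

definition ml_error :: "'o measure \<Rightarrow> 'a set \<Rightarrow> ('o \<Rightarrow> 'a) \<Rightarrow> ('o \<Rightarrow> 'b) \<Rightarrow> real" where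
  "ml_error P C X Y = \<P>(\<omega> in P. ml_decoder P C X Y (Y \<omega>) \<noteq> X \<omega>)"


section \<open>SPIR protocols\<close>

record ('m, 'u, 'r, 't, 'q, 'd) spir =
  file_set :: "'m set"
  seed_set :: "'u set"
  user_rand_set :: "'r set"
  rand_share_set :: "nat \<Rightarrow> 't set"
  query_set :: "nat \<Rightarrow> 'q set"
  answer_set :: "nat \<Rightarrow> 'd set"
  rand_share_map :: "'u \<Rightarrow> nat \<Rightarrow> 't"
  query_map :: "nat \<Rightarrow> 'r \<Rightarrow> nat \<Rightarrow> 'q"
  answer_map :: "nat \<Rightarrow> 'q \<Rightarrow> (nat \<Rightarrow> 'm) \<Rightarrow> 't \<Rightarrow> 'd"

definition spir_protocol ::
    "nat \<Rightarrow> nat \<Rightarrow> ('m, 'u, 'r, 't, 'q, 'd) spir \<Rightarrow> bool" where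
  "spir_protocol n f P \<longleftrightarrow>
     finite (file_set P) \<and> file_set P \<noteq> {} \<and>
     finite (seed_set P) \<and> seed_set P \<noteq> {} \<and>
     finite (user_rand_set P) \<and> user_rand_set P \<noteq> {} \<and>
     (\<forall>j<n. finite (rand_share_set P j) \<and> finite (query_set P j) \<and> finite (answer_set P j)) \<and>
     (\<forall>u\<in>seed_set P. rand_share_map P u \<in> (\<Pi>\<^sub>E j\<in>{..<n}. rand_share_set P j)) \<and>
     (\<forall>k<f. \<forall>r\<in>user_rand_set P. query_map P k r \<in> (\<Pi>\<^sub>E j\<in>{..<n}. query_set P j)) \<and>
     (\<forall>j<n. \<forall>q\<in>query_set P j. \<forall>m\<in>{..<f} \<rightarrow>\<^sub>E file_set P. \<forall>t\<in>rand_share_set P j.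
        answer_map P j q m t \<in> answer_set P j)"

text \<open>The joint law of \<open>(M, U, K, R)\<close>.\<close>

definition spir_space ::
    "nat \<Rightarrow> ('m, 'u, 'r, 't, 'q, 'd) spir \<Rightarrow> ((nat \<Rightarrow> 'm) \<times> 'u \<times> nat \<times> 'r) measure" where
  "spir_space f P = uniform_count_measure
     (({..<f} \<rightarrow>\<^sub>E file_set P) \<times> seed_set P \<times> {..<f} \<times> user_rand_set P)"

text \<open>The joint law conditioned on \<open>K = k\<close> and \<open>R = r\<close>.\<close>

definition spir_cond_space ::
    "nat \<Rightarrow> ('m, 'u, 'r, 't, 'q, 'd) spir \<Rightarrow> nat \<Rightarrow> 'r \<Rightarrow>
     ((nat \<Rightarrow> 'm) \<times> 'u \<times> nat \<times> 'r) measure" where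
  "spir_cond_space f P k r =
     uniform_measure (spir_space f P) {(M, U, K, R) \<in> space (spir_space f P). K = k \<and> R = r}"

definition spir_queries ::
    "('m, 'u, 'r, 't, 'q, 'd) spir \<Rightarrow> nat set \<Rightarrow>
     (nat \<Rightarrow> 'm) \<times> 'u \<times> nat \<times> 'r \<Rightarrow> nat \<Rightarrow> 'q" where
  "spir_queries P X = (\<lambda>(M, U, K, R). \<lambda>j\<in>X. query_map P K R j)"

definition spir_answers ::
    "('m, 'u, 'r, 't, 'q, 'd) spir \<Rightarrow> nat set \<Rightarrow>
     (nat \<Rightarrow> 'm) \<times> 'u \<times> nat \<times> 'r \<Rightarrow> nat \<Rightarrow> 'd" where
  "spir_answers P X =
     (\<lambda>(M, U, K, R). \<lambda>j\<in>X. answer_map P j (query_map P K R j) M (rand_share_map P U j))"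

definition spir_correct ::
    "nat set set \<Rightarrow> nat \<Rightarrow> ('m, 'u, 'r, 't, 'q, 'd) spir \<Rightarrow> bool" where
  "spir_correct \<AA> f P \<longleftrightarrow>
     (\<forall>r\<in>user_rand_set P. \<forall>k<f. \<forall>A\<in>\<AA>.
        ml_error (spir_cond_space f P k r) (file_set P)
          (\<lambda>(M, U, K, R). M k) (spir_answers P A) = 0)"

definition spir_server_secret ::
    "nat \<Rightarrow> nat \<Rightarrow> ('m, 'u, 'r, 't, 'q, 'd) spir \<Rightarrow> bool" where
  "spir_server_secret n f P \<longleftrightarrow>
     (\<forall>r\<in>user_rand_set P. \<forall>k<f.
        mutual_info (spir_cond_space f P k r)
          (spir_answers P {..<n}) (\<lambda>(M, U, K, R). restrict M ({..<f} - {k})) = 0)"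

definition spir_user_secret ::
    "nat set set \<Rightarrow> nat \<Rightarrow> ('m, 'u, 'r, 't, 'q, 'd) spir \<Rightarrow> bool" where
  "spir_user_secret \<BB> f P \<longleftrightarrow>
     (\<forall>B\<in>\<BB>. mutual_info (spir_space f P) (\<lambda>(M, U, K, R). K) (spir_queries P B) = 0)"

definition csspir ::
    "nat set set \<Rightarrow> nat set set \<Rightarrow> nat \<Rightarrow> nat \<Rightarrow> ('m, 'u, 'r, 't, 'q, 'd) spir \<Rightarrow> bool" where
  "csspir \<AA> \<BB> n f P \<longleftrightarrow>
     spir_protocol n f P \<and> spir_correct \<AA> f P \<and> spir_server_secret n f P \<and> spir_user_secret \<BB> f P"

definition pir_rate :: "nat \<Rightarrow> ('m, 'u, 'r, 't, 'q, 'd) spir \<Rightarrow> real" where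
  "pir_rate n P = log 2 (card (file_set P)) / (\<Sum>j<n. log 2 (card (answer_set P j)))"

definition shared_randomness_rate :: "('m, 'u, 'r, 't, 'q, 'd) spir \<Rightarrow> real" where
  "shared_randomness_rate P = log 2 (card (seed_set P)) / log 2 (card (file_set P))"


section \<open>Linear SPIR protocols\<close>

definition positions :: "nat \<Rightarrow> (nat \<Rightarrow> nat) \<Rightarrow> nat set \<Rightarrow> nat set" where
  "positions z \<tau> X = {i. i < z \<and> \<tau> i \<in> X}"

definition subrows :: "'a mat \<Rightarrow> nat set \<Rightarrow> 'a mat" where
  "subrows A I = submatrix A I UNIV"

definition concat_files :: "nat \<Rightarrow> nat \<Rightarrow> (nat \<Rightarrow> 'a Matrix.vec) \<Rightarrow> 'a Matrix.vec" where
  "concat_files f x M = Matrix.vec (f * x) (\<lambda>i. M (i div x) $ (i mod x))"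

definition linear_spir_protocol ::
    "nat \<Rightarrow> nat \<Rightarrow> nat \<Rightarrow> nat \<Rightarrow> nat \<Rightarrow> (nat \<Rightarrow> nat) \<Rightarrow>
     'a::{field,finite} mat \<Rightarrow> 'r set \<Rightarrow> (nat \<Rightarrow> 'r \<Rightarrow> 'a mat) \<Rightarrow>
     ('a Matrix.vec, 'a Matrix.vec, 'r, 'a Matrix.vec, 'a mat, 'a Matrix.vec) spir" where
  "linear_spir_protocol n f x y z \<tau> H Rs Q =
     \<lparr> file_set = carrier_vec x,
       seed_set = carrier_vec y,
       user_rand_set = Rs,
       rand_share_set = (\<lambda>j. carrier_vec (card (positions z \<tau> {j}))),
       query_set = (\<lambda>j. carrier_mat (card (positions z \<tau> {j})) (f * x)),
       answer_set = (\<lambda>j. carrier_vec (card (positions z \<tau> {j}))),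
       rand_share_map = (\<lambda>u. \<lambda>j\<in>{..<n}. subrows H (positions z \<tau> {j}) *\<^sub>v u),
       query_map = (\<lambda>k r. \<lambda>j\<in>{..<n}. subrows (Q k r) (positions z \<tau> {j})),
       answer_map = (\<lambda>j q m t. q *\<^sub>v concat_files f x m + t) \<rparr>"

definition linear_spir ::
    "nat \<Rightarrow> nat \<Rightarrow> nat \<Rightarrow> nat \<Rightarrow> nat \<Rightarrow> (nat \<Rightarrow> nat) \<Rightarrow>
     ('a::{field,finite} Matrix.vec, 'a Matrix.vec, 'r, 'a Matrix.vec, 'a mat, 'a Matrix.vec) spir
     \<Rightarrow> bool" where
  "linear_spir n f x y z \<tau> P \<longleftrightarrow>
     (\<exists>H Rs Q. H \<in> carrier_mat z y \<and>
        (\<forall>k<f. \<forall>r\<in>Rs. Q k r \<in> carrier_mat z (f * x)) \<and>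
        P = linear_spir_protocol n f x y z \<tau> H Rs Q)"

definition block_unit_mat :: "nat \<Rightarrow> nat \<Rightarrow> nat \<Rightarrow> 'a::{zero,one} mat" where
  "block_unit_mat f x k = Matrix.mat x (f * x) (\<lambda>(i, j). if j = k * x + i then 1 else 0)"

definition projected_linear_spir ::
    "nat \<Rightarrow> nat \<Rightarrow> nat \<Rightarrow> nat \<Rightarrow> nat \<Rightarrow> (nat \<Rightarrow> nat) \<Rightarrow>
     ('a::{field,finite} Matrix.vec, 'a Matrix.vec, 'a mat, 'a Matrix.vec, 'a mat, 'a Matrix.vec) spir
     \<Rightarrow> bool" where
  "projected_linear_spir n f x y z \<tau> P \<longleftrightarrow>
     (\<exists>H J. H \<in> carrier_mat z y \<and> J \<in> carrier_mat z x \<and>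
        P = linear_spir_protocol n f x y z \<tau> H (carrier_mat y (f * x))
              (\<lambda>k R. J * block_unit_mat f x k + H * R))"


section \<open>NSS protocols\<close>

record ('m, 'u, 's) nss =
  secret_set :: "'m set"
  nss_seed_set :: "'u set"
  nss_share_set :: "nat \<Rightarrow> 's set"
  nss_share_map :: "'m \<Rightarrow> 'u \<Rightarrow> nat \<Rightarrow> 's"

definition nss_protocol :: "nat \<Rightarrow> ('m, 'u, 's) nss \<Rightarrow> bool" where
  "nss_protocol n P \<longleftrightarrow>
     finite (secret_set P) \<and> secret_set P \<noteq> {} \<and>
     finite (nss_seed_set P) \<and> nss_seed_set P \<noteq> {} \<and>
     (\<forall>j<n. finite (nss_share_set P j)) \<and>
     (\<forall>l\<in>secret_set P. \<forall>u\<in>nss_seed_set P.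
        nss_share_map P l u \<in> (\<Pi>\<^sub>E j\<in>{..<n}. nss_share_set P j))"

definition nss_space :: "('m, 'u, 's) nss \<Rightarrow> ('m \<times> 'u) measure" where
  "nss_space P = uniform_count_measure (secret_set P \<times> nss_seed_set P)"

definition nss_shares :: "('m, 'u, 's) nss \<Rightarrow> nat set \<Rightarrow> 'm \<times> 'u \<Rightarrow> nat \<Rightarrow> 's" where
  "nss_shares P X = (\<lambda>(L, U). \<lambda>j\<in>X. nss_share_map P L U j)"

definition csnss ::
    "nat set set \<Rightarrow> nat set set \<Rightarrow> nat \<Rightarrow> ('m, 'u, 's) nss \<Rightarrow> bool" where
  "csnss \<AA> \<BB> n P \<longleftrightarrow>
     nss_protocol n P \<and>
     (\<forall>A\<in>\<AA>. ml_error (nss_space P) (secret_set P) (\<lambda>(L, U). L) (nss_shares P A) = 0) \<and>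
     (\<forall>B\<in>\<BB>. mutual_info (nss_space P) (\<lambda>(L, U). L) (nss_shares P B) = 0)"

definition ss_rate :: "nat \<Rightarrow> ('m, 'u, 's) nss \<Rightarrow> real" where
  "ss_rate n P = log 2 (card (secret_set P)) / (\<Sum>j<n. log 2 (card (nss_share_set P j)))"

definition nss_randomness_rate :: "('m, 'u, 's) nss \<Rightarrow> real" where
  "nss_randomness_rate P = log 2 (card (nss_seed_set P)) / log 2 (card (secret_set P))"

text \<open>The vector analogue of \<^const>\<open>submatrix\<close>: the entries of \<open>v\<close> at positions in \<open>I\<close>.\<close>

definition subvec :: "'a Matrix.vec \<Rightarrow> nat set \<Rightarrow> 'a Matrix.vec" where
  "subvec v I = Matrix.vec (card {i. i < dim_vec v \<and> i \<in> I}) (\<lambda>i. v $ pick I i)"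

definition linear_nss ::
    "nat \<Rightarrow> nat \<Rightarrow> nat \<Rightarrow> nat \<Rightarrow> (nat \<Rightarrow> nat) \<Rightarrow>
     ('a::{field,finite} Matrix.vec, 'a Matrix.vec, 'a Matrix.vec) nss \<Rightarrow> bool" where
  "linear_nss n x y z \<tau> P \<longleftrightarrow>
     (\<exists>\<psi>. linear_map class_ring (module_vec TYPE('a) (x + y)) (module_vec TYPE('a) z) \<psi> \<and>
        P = \<lparr> secret_set = carrier_vec x,
              nss_seed_set = carrier_vec y,
              nss_share_set = (\<lambda>j. carrier_vec (card (positions z \<tau> {j}))),
              nss_share_map = (\<lambda>l u. \<lambda>j\<in>{..<n}. subvec (\<psi> (l @\<^sub>v u)) (positions z \<tau> {j})) \<rparr>)"


section \<open>Multi-target monotone span programs\<close>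

definition target_vectors :: "nat \<Rightarrow> nat \<Rightarrow> 'a::zero_neq_one Matrix.vec set" where
  "target_vectors x y = {unit_vec (x + y) i | i. i < x}"

definition mmsp ::
    "nat set set \<Rightarrow> nat set set \<Rightarrow> nat \<Rightarrow> nat \<Rightarrow> nat \<Rightarrow> 'a::{field,finite} mat \<Rightarrow>
     (nat \<Rightarrow> nat) \<Rightarrow> bool" where
  "mmsp \<AA> \<BB> x y z G \<tau> \<longleftrightarrow>
     G \<in> carrier_mat z (x + y) \<and>
     (\<forall>A\<in>\<AA>. target_vectors x y \<subseteq>
        vec_space.row_space (x + y) (subrows G (positions z \<tau> A))) \<and>
     (\<forall>B\<in>\<BB>. LinearCombinations.module.span class_ring (module_vec TYPE('a) (x + y))
          (target_vectors x y) \<inter>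
        vec_space.row_space (x + y) (subrows G (positions z \<tau> B)) = {0\<^sub>v (x + y)})"

end

theory Submission
  imports Defs
begin

text \<open>
  All four conditions say that some \<open>G\<close> satisfies: for \<open>A \<in> \<AA>\<close>, \<open>G\<^sub>A (l, u) = 0\<close> forces \<open>l = 0\<close>, and
  for \<open>B \<in> \<BB>\<close>, every \<open>l\<close> has some \<open>u\<close> with \<open>G\<^sub>B (l, u) = 0\<close>. For span programs this is linear duality.
  For the probabilistic conditions: on a uniform finite space, zero decoding error means that one
  variable is a function of the other, and independence can be tested by matching fibres.

  Given such a \<open>G = (J, H)\<close>, the replies of the projected protocol are the shares of \<open>M\<^sub>k\<close> with seed
  \<open>R M + U\<close>, and on the rows of \<open>B\<close> the queries for \<open>k\<close> and \<open>k'\<close> differ by a shift of \<open>R\<close>. Conversely,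
  server secrecy and correctness for all servers force the query columns of the unwanted files into
  the range of \<open>H\<close>. By user secrecy the rows of \<open>B\<close> in a query for file \<open>0\<close> also occur in a query for
  file \<open>1\<close>, where file \<open>0\<close> is unwanted; so on \<open>B\<close> its columns lie in the range of \<open>H\<^sub>B\<close>.
\<close>

section \<open>Uniform finite probability spaces\<close>

text \<open>The implications are not chained: each condition is compared with the same kernel
  condition on one matrix. Conditioning by \<open>uniform_measure\<close> leaves the sample space
  unchanged, so a support \<open>T\<close> is carried separately from \<open>space P\<close>; the
  conditional and unconditional laws then obey one set of counting lemmas. Mutual information is a
  divergence of measures. Once reduced to cardinalities it is used in just two ways: attained values
  of independent variables are attained together, and injections between the fibres of one variable
  that preserve the other give independence. In the converse for SPIR, a nonempty \<AA> closed under
  supersets makes the set of all servers authorised, and \<open>f \<ge> 2\<close> supplies the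
  second file. The user randomness has different types in (a) and (d), so the construction works
  with any bijective labelling of the matrices \<open>R\<close>.\<close>

definition uniform_on :: "'o measure \<Rightarrow> 'o set \<Rightarrow> bool" where
  "uniform_on P T \<longleftrightarrow>
     finite (space P) \<and> sets P = Pow (space P) \<and> T \<subseteq> space P \<and> T \<noteq> {} \<and>
     (\<forall>E\<subseteq>space P. emeasure P E = ennreal (card (E \<inter> T) / card T))"

lemma uniform_on_finite: "uniform_on P T \<Longrightarrow> finite T"
  unfolding uniform_on_def by (auto intro: finite_subset)

lemma uniform_on_measure:
  "uniform_on P T \<Longrightarrow> E \<subseteq> space P \<Longrightarrow> measure P E = card (E \<inter> T) / card T"
  unfolding uniform_on_def measure_def by simp

lemma uniform_on_measure_Collect:
  assumes "uniform_on P T"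
  shows "measure P {\<omega> \<in> space P. \<phi> \<omega>} = card {\<omega> \<in> T. \<phi> \<omega>} / card T"
proof -
  have "{\<omega> \<in> space P. \<phi> \<omega>} \<inter> T = {\<omega> \<in> T. \<phi> \<omega>}"
    using assms unfolding uniform_on_def by auto
  then show ?thesis using uniform_on_measure[OF assms, of "{\<omega> \<in> space P. \<phi> \<omega>}"] by auto
qed

lemma uniform_on_prob_space:
  assumes "uniform_on P T"
  shows "prob_space P"
proof
  have "T \<subseteq> space P" "T \<noteq> {}" using assms unfolding uniform_on_def by auto
  then show "emeasure P (space P) = 1"
    using assms uniform_on_finite[OF assms] unfolding uniform_on_def
    by (simp add: Int_absorb1)
qed

lemma uniform_on_uniform_count_measure:
  "finite S \<Longrightarrow> S \<noteq> {} \<Longrightarrow> uniform_on (uniform_count_measure S) S"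
  unfolding uniform_on_def
  by (auto simp: space_uniform_count_measure sets_uniform_count_measure
      emeasure_uniform_count_measure Int_absorb2)

lemma uniform_on_uniform_measure:
  assumes fin: "finite S" and T: "T \<subseteq> S" "T \<noteq> {}"
  shows "uniform_on (uniform_measure (uniform_count_measure S) T) T"
  unfolding uniform_on_def
proof (intro conjI allI impI)
  fix E assume "E \<subseteq> space (uniform_measure (uniform_count_measure S) T)"
  then have E: "E \<subseteq> S" by (simp add: space_uniform_count_measure)
  have pos: "card T > 0" "card S > 0"
    using fin T by (auto simp: card_gt_0_iff finite_subset)
  have "emeasure (uniform_measure (uniform_count_measure S) T) E
      = ennreal (card (T \<inter> E) / card S) / ennreal (card T / card S)"
    using E T fin
    by (subst emeasure_uniform_measure)
       (auto simp: sets_uniform_count_measure emeasure_uniform_count_measure le_infI1)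
  also have "\<dots> = ennreal (card (E \<inter> T) / card T)"
    using pos by (subst divide_ennreal) (auto simp: Int_commute)
  finally show "emeasure (uniform_measure (uniform_count_measure S) T) E
      = ennreal (card (E \<inter> T) / card T)" .
qed (use fin T in \<open>auto simp: space_uniform_count_measure sets_uniform_count_measure\<close>)

text \<open>Every outcome in \<open>T\<close> has positive mass, so zero error means that the
  decoder is right at each of them. If \<open>X\<close> is a function of \<open>Y\<close> on
  \<open>T\<close>, the true value is the only one with positive likelihood; the maximiser is unique
  and tie-breaking is irrelevant.\<close>

lemma ml_error_eq_0_iff:
  assumes P: "uniform_on P T" and C: "X ` T \<subseteq> C"
  shows "ml_error P C X Y = 0 \<longleftrightarrow> (\<forall>\<omega>\<in>T. \<forall>\<omega>'\<in>T. Y \<omega> = Y \<omega>' \<longrightarrow> X \<omega> = X \<omega>')"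
proof -
  note fin = uniform_on_finite[OF P]
  have "ml_error P C X Y = 0 \<longleftrightarrow> (\<forall>\<omega>\<in>T. ml_decoder P C X Y (Y \<omega>) = X \<omega>)"
    using P fin unfolding ml_error_def uniform_on_measure_Collect[OF P]
    by (auto simp: uniform_on_def card_eq_0_iff)
  also have "\<dots> \<longleftrightarrow> (\<forall>\<omega>\<in>T. \<forall>\<omega>'\<in>T. Y \<omega> = Y \<omega>' \<longrightarrow> X \<omega> = X \<omega>')"
  proof (intro iffI ballI impI)
    fix \<omega> \<omega>' assume d: "\<forall>\<omega>\<in>T. ml_decoder P C X Y (Y \<omega>) = X \<omega>" and "\<omega> \<in> T" "\<omega>' \<in> T" "Y \<omega> = Y \<omega>'"
    then show "X \<omega> = X \<omega>'"
      using bspec[OF d, of \<omega>] bspec[OF d, of \<omega>'] by simp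
  next
    fix \<omega> assume f: "\<forall>\<omega>\<in>T. \<forall>\<omega>'\<in>T. Y \<omega> = Y \<omega>' \<longrightarrow> X \<omega> = X \<omega>'" and \<omega>: "\<omega> \<in> T"
    define L where "L x = \<P>(\<omega>' in P. Y \<omega>' = Y \<omega> \<bar> X \<omega>' = x)" for x
    have L: "L x = (card {\<omega>' \<in> T. Y \<omega>' = Y \<omega> \<and> X \<omega>' = x} / card T) / (card {\<omega>' \<in> T. X \<omega>' = x} / card T)" for x
      unfolding L_def cond_prob_def uniform_on_measure_Collect[OF P] by simp
    \<comment> \<open>This includes values of \<open>C\<close> that \<open>X\<close> never takes on
      \<open>T\<close>: there the quotient is 0/0, which is 0.\<close>
    have z: "L x = 0" if "x \<noteq> X \<omega>" for x
    proof -
      have e: "{\<omega>' \<in> T. Y \<omega>' = Y \<omega> \<and> X \<omega>' = x} = {}" using f \<omega> that by blast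
      show ?thesis unfolding L e by simp
    qed
    have "card {\<omega>' \<in> T. Y \<omega>' = Y \<omega> \<and> X \<omega>' = X \<omega>} > 0" "card {\<omega>' \<in> T. X \<omega>' = X \<omega>} > 0" "card T > 0"
      using fin \<omega> by (auto simp: card_gt_0_iff)
    then have p: "L (X \<omega>) > 0"
      unfolding L by simp
    have "arg_max_on L C = X \<omega>"
      unfolding arg_max_on_def
    proof (rule arg_maxI)
      show "X \<omega> \<in> C" using C \<omega> by auto
      show "\<not> L (X \<omega>) < L y" for y using z[of y] p by (cases "y = X \<omega>") auto
      show "x = X \<omega>" if "\<forall>y. y \<in> C \<longrightarrow> \<not> L x < L y" for x
        using that C \<omega> z[of x] p by force
    qed
    then show "ml_decoder P C X Y (Y \<omega>) = X \<omega>" unfolding ml_decoder_def L_def .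
  qed
  finally show ?thesis .
qed

section \<open>Vanishing mutual information as a counting identity\<close>

context
  fixes P :: "'o measure" and T :: "'o set" and X :: "'o \<Rightarrow> 'a" and Y :: "'o \<Rightarrow> 'b"
  assumes P: "uniform_on P T"
begin

interpretation information_space P 2
  using uniform_on_prob_space[OF P] by (simp add: information_space_def information_space_axioms_def)

lemma uniform_on_measurable: "f ` space P \<subseteq> A \<Longrightarrow> f \<in> measurable P (count_space A)"
  using P by (auto simp: uniform_on_def measurable_def)

text \<open>A divergence vanishes exactly when the two laws agree, provided the joint law is
  absolutely continuous with respect to the product and the entropy density is integrable.
  Finiteness of the sample space yields both.\<close>

lemma mutual_info_eq_0_iff_distr:
  "mutual_info P X Y = 0 \<longleftrightarrow>
     distr P (count_space (X ` space P)) X \<Otimes>\<^sub>M distr P (count_space (Y ` space P)) Y =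
     distr P (count_space (X ` space P) \<Otimes>\<^sub>M count_space (Y ` space P)) (\<lambda>\<omega>. (X \<omega>, Y \<omega>))"
proof -
  let ?S = "count_space (X ` space P)" and ?R = "count_space (Y ` space P)"
  let ?D = "distr P ?S X \<Otimes>\<^sub>M distr P ?R Y" and ?J = "distr P (?S \<Otimes>\<^sub>M ?R) (\<lambda>\<omega>. (X \<omega>, Y \<omega>))"
  have fin: "finite (X ` space P)" "finite (Y ` space P)" using P by (auto simp: uniform_on_def)
  have SR: "?S \<Otimes>\<^sub>M ?R = count_space (X ` space P \<times> Y ` space P)"
    using fin by (simp add: pair_measure_count_space)
  have mX: "X \<in> measurable P ?S" and mY: "Y \<in> measurable P ?R"
    by (auto intro: uniform_on_measurable)
  have mXY: "(\<lambda>\<omega>. (X \<omega>, Y \<omega>)) \<in> measurable P (?S \<Otimes>\<^sub>M ?R)"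
    using mX mY by (rule measurable_Pair)
  interpret dX: prob_space "distr P ?S X" by (rule prob_space_distr) fact
  interpret dY: prob_space "distr P ?R Y" by (rule prob_space_distr) fact
  interpret dJ: prob_space ?J by (rule prob_space_distr) fact
  interpret XY: pair_prob_space "distr P ?S X" "distr P ?R Y" by standard
  interpret D: information_space ?D 2 by standard simp
  have setsD: "sets ?D = Pow (X ` space P \<times> Y ` space P)"
    using SR by (metis sets_count_space sets_distr sets_pair_measure_cong)
  have setsJ: "sets ?J = Pow (X ` space P \<times> Y ` space P)"
    using SR by simp
  have sP: "sets P = Pow (space P)" using P by (simp add: uniform_on_def)
  \<comment> \<open>At each point of a product-null set one of the marginals vanishes, and that
    marginal bounds the joint mass of the point. Only finitely many points have to be
    collected.\<close>
  have ac: "absolutely_continuous ?D ?J"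
    unfolding absolutely_continuous_def
  proof
    fix N assume "N \<in> null_sets ?D"
    then have N: "N \<subseteq> X ` space P \<times> Y ` space P" "emeasure ?D N = 0"
      using setsD by (auto simp: null_sets_def)
    have "emeasure P {\<omega> \<in> space P. X \<omega> = a \<and> Y \<omega> = b} = 0" if ab: "(a, b) \<in> N" for a b
    proof -
      have "emeasure ?D ({a} \<times> {b}) \<le> emeasure ?D N"
        using ab N setsD by (intro emeasure_mono) auto
      then have "emeasure (distr P ?S X) {a} * emeasure (distr P ?R Y) {b} = 0"
        using N ab by (subst (asm) dY.emeasure_pair_measure_Times) auto
      then have "emeasure P {\<omega> \<in> space P. X \<omega> = a} = 0 \<or> emeasure P {\<omega> \<in> space P. Y \<omega> = b} = 0"
        using N ab mX mY by (auto simp: emeasure_distr vimage_def Int_def conj_commute)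
      moreover have "emeasure P {\<omega> \<in> space P. X \<omega> = a \<and> Y \<omega> = b} \<le> emeasure P {\<omega> \<in> space P. X \<omega> = a}"
        "emeasure P {\<omega> \<in> space P. X \<omega> = a \<and> Y \<omega> = b} \<le> emeasure P {\<omega> \<in> space P. Y \<omega> = b}"
        using sP by (auto intro!: emeasure_mono)
      ultimately show ?thesis by auto
    qed
    moreover have "(\<lambda>\<omega>. (X \<omega>, Y \<omega>)) -` N \<inter> space P
        = (\<Union>p\<in>N. {\<omega> \<in> space P. X \<omega> = fst p \<and> Y \<omega> = snd p})" by auto
    moreover have "finite N" using N fin by (meson finite_SigmaI finite_subset)
    moreover have "{\<omega> \<in> space P. X \<omega> = a \<and> Y \<omega> = b} \<in> sets P" for a b
      using sP by auto
    ultimately have "(\<lambda>\<omega>. (X \<omega>, Y \<omega>)) -` N \<inter> space P \<in> null_sets P"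
      by (simp only:) (intro null_sets.finite_UN null_setsI; simp)
    then show "N \<in> null_sets ?J"
      using N mXY setsJ by (subst null_sets_distr_iff) auto
  qed
  \<comment> \<open>The density takes finitely many values, so its largest norm is a bound.\<close>
  have int: "integrable ?J (entropy_density 2 ?D ?J)"
  proof (rule dJ.integrable_const_bound)
    show "AE p in ?J. norm (entropy_density 2 ?D ?J p)
        \<le> Max ((\<lambda>p. norm (entropy_density 2 ?D ?J p)) ` (X ` space P \<times> Y ` space P))"
      using fin by (intro AE_I2 Max_ge) (auto simp: space_pair_measure)
    show "entropy_density 2 ?D ?J \<in> borel_measurable ?J"
      by (simp add: SR)
  qed
  have "mutual_info P X Y = KL_divergence 2 ?D ?J"
    unfolding mutual_info_def mutual_information_def ..
  moreover have "KL_divergence 2 ?D ?J = 0 \<longleftrightarrow> ?J = ?D"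
    by (rule D.KL_eq_0_iff_eq_ac) (use setsD setsJ ac int dJ.prob_space_axioms in auto)
  ultimately show ?thesis by auto
qed

text \<open>Independence at the point \<open>(a, b)\<close>, with the denominators
  \<open>card T\<close> cleared. Quantifying over all values of the types, not only the attained
  ones, spares later uses any argument about ranges.\<close>

lemma mutual_info_eq_0_iff_card:
  "mutual_info P X Y = 0 \<longleftrightarrow>
     (\<forall>a b. card {\<omega> \<in> T. X \<omega> = a} * card {\<omega> \<in> T. Y \<omega> = b}
          = card {\<omega> \<in> T. X \<omega> = a \<and> Y \<omega> = b} * card T)"
proof -
  let ?S = "count_space (X ` space P)" and ?R = "count_space (Y ` space P)"
  let ?D = "distr P ?S X \<Otimes>\<^sub>M distr P ?R Y" and ?J = "distr P (?S \<Otimes>\<^sub>M ?R) (\<lambda>\<omega>. (X \<omega>, Y \<omega>))"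
  let ?Q = "X ` space P \<times> Y ` space P"
  let ?N = "\<lambda>a b. card {\<omega> \<in> T. X \<omega> = a \<and> Y \<omega> = b}"
  have T: "T \<subseteq> space P" "card T > 0"
    using P uniform_on_finite[OF P] by (auto simp: uniform_on_def card_gt_0_iff)
  have fin: "finite (X ` space P)" "finite (Y ` space P)" using P by (auto simp: uniform_on_def)
  have SR: "?S \<Otimes>\<^sub>M ?R = count_space ?Q"
    using fin by (simp add: pair_measure_count_space)
  have mX: "X \<in> measurable P ?S" and mY: "Y \<in> measurable P ?R"
    by (auto intro: uniform_on_measurable)
  have mXY: "(\<lambda>\<omega>. (X \<omega>, Y \<omega>)) \<in> measurable P (?S \<Otimes>\<^sub>M ?R)"
    using mX mY by (rule measurable_Pair)
  interpret dX: prob_space "distr P ?S X" by (rule prob_space_distr) fact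
  interpret dY: prob_space "distr P ?R Y" by (rule prob_space_distr) fact
  have setsD: "sets ?D = Pow ?Q"
    using SR by (metis sets_count_space sets_distr sets_pair_measure_cong)
  have setsJ: "sets ?J = Pow ?Q" using SR by simp
  have D: "emeasure ?D {(a, b)}
      = ennreal ((card {\<omega> \<in> T. X \<omega> = a} / card T) * (card {\<omega> \<in> T. Y \<omega> = b} / card T))"
    if ab: "(a, b) \<in> ?Q" for a b
  proof -
    have "emeasure ?D {(a, b)} = emeasure (distr P ?S X) {a} * emeasure (distr P ?R Y) {b}"
      using ab by (subst dY.emeasure_pair_measure_Times[symmetric]) auto
    also have "\<dots> = emeasure P {\<omega> \<in> space P. X \<omega> = a} * emeasure P {\<omega> \<in> space P. Y \<omega> = b}"
      using ab mX mY by (simp add: emeasure_distr vimage_def Int_def conj_commute)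
    finally show ?thesis
      unfolding emeasure_eq_measure uniform_on_measure_Collect[OF P]
      by (simp only: ennreal_mult[symmetric] divide_nonneg_nonneg of_nat_0_le_iff)
  qed
  have J: "emeasure ?J {(a, b)} = ennreal (?N a b / card T)" if ab: "(a, b) \<in> ?Q" for a b
  proof -
    have "emeasure ?J {(a, b)} = emeasure P {\<omega> \<in> space P. X \<omega> = a \<and> Y \<omega> = b}"
      using ab mXY SR by (simp add: emeasure_distr vimage_def Int_def conj_commute)
    then show ?thesis
      unfolding emeasure_eq_measure uniform_on_measure_Collect[OF P] .
  qed
  have cell: "emeasure ?D {(a, b)} = emeasure ?J {(a, b)} \<longleftrightarrow>
      card {\<omega> \<in> T. X \<omega> = a} * card {\<omega> \<in> T. Y \<omega> = b} = ?N a b * card T"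
    if ab: "(a, b) \<in> ?Q" for a b
  proof -
    have "emeasure ?D {(a, b)} = emeasure ?J {(a, b)} \<longleftrightarrow>
        real (card {\<omega> \<in> T. X \<omega> = a}) * real (card {\<omega> \<in> T. Y \<omega> = b}) = real (?N a b) * real (card T)"
      unfolding D[OF ab] J[OF ab] using T
      by (subst ennreal_inj) (simp_all add: divide_eq_eq eq_divide_eq)
    also have "\<dots> \<longleftrightarrow> card {\<omega> \<in> T. X \<omega> = a} * card {\<omega> \<in> T. Y \<omega> = b} = ?N a b * card T"
      by (simp only: of_nat_mult[symmetric] of_nat_eq_iff)
    finally show ?thesis .
  qed
  \<comment> \<open>An unattained \<open>a\<close> or \<open>b\<close> makes a factor on the left
    zero, and the joint count on the right as well.\<close>
  have outside: "card {\<omega> \<in> T. X \<omega> = a} * card {\<omega> \<in> T. Y \<omega> = b} = ?N a b * card T"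
    if "(a, b) \<notin> ?Q" for a b
  proof -
    have "{\<omega> \<in> T. X \<omega> = a \<and> Y \<omega> = b} = {}" "{\<omega> \<in> T. X \<omega> = a} = {} \<or> {\<omega> \<in> T. Y \<omega> = b} = {}"
      using that T by auto
    then show ?thesis by (metis card.empty mult_0 mult_0_right)
  qed
  \<comment> \<open>Both measures are defined on all subsets of a finite set, so singletons decide
    equality.\<close>
  have "?D = ?J \<longleftrightarrow> (\<forall>p\<in>?Q. emeasure ?D {p} = emeasure ?J {p})"
  proof
    assume "\<forall>p\<in>?Q. emeasure ?D {p} = emeasure ?J {p}"
    then show "?D = ?J"
      by (intro measure_eqI_finite[OF setsD setsJ] finite_cartesian_product fin) (rule bspec)
  qed simp
  also have "\<dots> \<longleftrightarrow> (\<forall>a b. (a, b) \<in> ?Q \<longrightarrow> emeasure ?D {(a, b)} = emeasure ?J {(a, b)})"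
    by blast
  also have "\<dots> \<longleftrightarrow> (\<forall>a b. card {\<omega> \<in> T. X \<omega> = a} * card {\<omega> \<in> T. Y \<omega> = b} = ?N a b * card T)"
  proof (intro iff_allI)
    fix a b
    show "((a, b) \<in> ?Q \<longrightarrow> emeasure ?D {(a, b)} = emeasure ?J {(a, b)}) \<longleftrightarrow>
        card {\<omega> \<in> T. X \<omega> = a} * card {\<omega> \<in> T. Y \<omega> = b} = ?N a b * card T"
      by (cases "(a, b) \<in> ?Q") (simp_all only: cell outside simp_thms)
  qed
  finally show ?thesis unfolding mutual_info_eq_0_iff_distr .
qed

text \<open>A product of positive counts is positive, so the joint count is nonzero. This is the
  form in which secrecy hypotheses are exploited: one observed value can be combined with any other
  value of the secret variable.\<close>

lemma mutual_info_eq_0_imp_support: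
  assumes "mutual_info P X Y = 0" "\<omega>1 \<in> T" "\<omega>2 \<in> T"
  obtains \<omega> where "\<omega> \<in> T" "X \<omega> = X \<omega>1" "Y \<omega> = Y \<omega>2"
proof -
  have "card {\<omega> \<in> T. X \<omega> = X \<omega>1} > 0" "card {\<omega> \<in> T. Y \<omega> = Y \<omega>2} > 0"
    using uniform_on_finite[OF P] assms by (auto simp: card_gt_0_iff)
  then have "0 < card {\<omega> \<in> T. X \<omega> = X \<omega>1} * card {\<omega> \<in> T. Y \<omega> = Y \<omega>2}" by simp
  also have "\<dots> = card {\<omega> \<in> T. X \<omega> = X \<omega>1 \<and> Y \<omega> = Y \<omega>2} * card T"
    using assms(1) unfolding mutual_info_eq_0_iff_card by blast
  finally have "card {\<omega> \<in> T. X \<omega> = X \<omega>1 \<and> Y \<omega> = Y \<omega>2} \<noteq> 0" by simp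
  then obtain \<omega> where "\<omega> \<in> {\<omega> \<in> T. X \<omega> = X \<omega>1 \<and> Y \<omega> = Y \<omega>2}"
    by (metis card.empty equals0I)
  with that show ?thesis by blast
qed

text \<open>If the fibres of \<open>X\<close> inject into one another preserving \<open>Y\<close>, then every fibre of \<open>X\<close> has
  the same distribution of \<open>Y\<close>.\<close>

lemma mutual_info_eq_0I:
  assumes inv: "\<And>\<omega>1 \<omega>2. \<omega>1 \<in> T \<Longrightarrow> \<omega>2 \<in> T \<Longrightarrow>
    \<exists>\<sigma>. inj_on \<sigma> {\<omega> \<in> T. X \<omega> = X \<omega>1} \<and>
        (\<forall>\<omega>\<in>T. X \<omega> = X \<omega>1 \<longrightarrow> \<sigma> \<omega> \<in> T \<and> X (\<sigma> \<omega>) = X \<omega>2 \<and> Y (\<sigma> \<omega>) = Y \<omega>)"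
  shows "mutual_info P X Y = 0"
proof -
  let ?N = "\<lambda>a b. card {\<omega> \<in> T. X \<omega> = a \<and> Y \<omega> = b}"
  note finT = uniform_on_finite[OF P]
  have le: "?N (X \<omega>1) b \<le> ?N (X \<omega>2) b" if \<omega>: "\<omega>1 \<in> T" "\<omega>2 \<in> T" for \<omega>1 \<omega>2 b
  proof -
    obtain \<sigma> where "inj_on \<sigma> {\<omega> \<in> T. X \<omega> = X \<omega>1}"
      and "\<And>\<omega>. \<omega> \<in> T \<Longrightarrow> X \<omega> = X \<omega>1 \<Longrightarrow> \<sigma> \<omega> \<in> T \<and> X (\<sigma> \<omega>) = X \<omega>2 \<and> Y (\<sigma> \<omega>) = Y \<omega>"
      using inv[OF \<omega>] by blast
    then show ?thesis
      using finT by (intro card_inj_on_le[of \<sigma>]) (auto intro: inj_on_subset)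
  qed
  obtain \<omega>0 where \<omega>0: "\<omega>0 \<in> T" using P by (auto simp: uniform_on_def)
  define c where "c b = ?N (X \<omega>0) b" for b
  \<comment> \<open>Injections exist in both directions between any two fibres, so the joint count
    depends on \<open>b\<close> alone.\<close>
  have N: "?N a b = c b" if "a \<in> X ` T" for a b
    unfolding c_def using that le \<omega>0 by (auto intro: antisym)
  \<comment> \<open>For attained \<open>a\<close>, the three counts below turn both sides of the
    criterion into \<open>c b\<close> times the number of attained values of \<open>X\<close> times
    the sum of \<open>c\<close>.\<close>
  have cY: "card {\<omega> \<in> T. Y \<omega> = b} = card (X ` T) * c b" for b
  proof -
    have "{\<omega> \<in> T. Y \<omega> = b} = (\<Union>a\<in>X ` T. {\<omega> \<in> T. X \<omega> = a \<and> Y \<omega> = b})" by auto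
    then have "card {\<omega> \<in> T. Y \<omega> = b} = card (\<Union>a\<in>X ` T. {\<omega> \<in> T. X \<omega> = a \<and> Y \<omega> = b})"
      by (rule arg_cong)
    also have "\<dots> = (\<Sum>a\<in>X ` T. ?N a b)"
      using finT by (intro card_UN_disjoint) auto
    finally show ?thesis using N by simp
  qed
  have cX: "card {\<omega> \<in> T. X \<omega> = a} = (\<Sum>b\<in>Y ` T. c b)" if a: "a \<in> X ` T" for a
  proof -
    have "{\<omega> \<in> T. X \<omega> = a} = (\<Union>b\<in>Y ` T. {\<omega> \<in> T. X \<omega> = a \<and> Y \<omega> = b})" by auto
    then have "card {\<omega> \<in> T. X \<omega> = a} = card (\<Union>b\<in>Y ` T. {\<omega> \<in> T. X \<omega> = a \<and> Y \<omega> = b})"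
      by (rule arg_cong)
    also have "\<dots> = (\<Sum>b\<in>Y ` T. ?N a b)"
      using finT by (intro card_UN_disjoint) auto
    finally show ?thesis using N[OF a] by simp
  qed
  have cT: "card T = card (X ` T) * (\<Sum>b\<in>Y ` T. c b)"
  proof -
    have "T = (\<Union>a\<in>X ` T. {\<omega> \<in> T. X \<omega> = a})" by auto
    then have "card T = card (\<Union>a\<in>X ` T. {\<omega> \<in> T. X \<omega> = a})" by (rule arg_cong)
    also have "\<dots> = (\<Sum>a\<in>X ` T. card {\<omega> \<in> T. X \<omega> = a})"
      using finT by (intro card_UN_disjoint) auto
    finally show ?thesis using cX by simp
  qed
  show ?thesis
    unfolding mutual_info_eq_0_iff_card
  proof (intro allI)
    fix a b
    show "card {\<omega> \<in> T. X \<omega> = a} * card {\<omega> \<in> T. Y \<omega> = b} = ?N a b * card T"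
    proof (cases "a \<in> X ` T")
      case True
      then show ?thesis using N cX cY cT by simp
    next
      case False
      then have e: "{\<omega> \<in> T. X \<omega> = a} = {}" "{\<omega> \<in> T. X \<omega> = a \<and> Y \<omega> = b} = {}" by auto
      show ?thesis unfolding e by simp
    qed
  qed
qed

end

text \<open>Server secrecy lists the answers first, whereas fibres are to be matched over the
  files.\<close>

lemma mutual_info_commute_eq_0:
  assumes "uniform_on P T"
  shows "mutual_info P X Y = 0 \<longleftrightarrow> mutual_info P Y X = 0"
proof -
  have "{\<omega> \<in> T. X \<omega> = a \<and> Y \<omega> = b} = {\<omega> \<in> T. Y \<omega> = b \<and> X \<omega> = a}" for a b by blast
  then show ?thesis
    unfolding mutual_info_eq_0_iff_card[OF assms] by (simp only: mult.commute) blast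
qed

section \<open>Linear duality and span programs\<close>

text \<open>The Fredholm alternative: either \<open>w\<close> is a combination of the
  \<open>g i\<close>, or some functional kills every \<open>g i\<close> but not \<open>w\<close>.
  Stating it for functions on index sets lets it serve for the rows and for the columns of a matrix
  alike.\<close>

lemma combination_or_separating_functional:
  fixes g :: "'i \<Rightarrow> 'j \<Rightarrow> 'a::field" and w :: "'j \<Rightarrow> 'a"
  assumes "finite I" "finite J"
  shows "(\<exists>c. \<forall>j\<in>J. w j = (\<Sum>i\<in>I. c i * g i j)) \<or>
    (\<exists>v. (\<forall>i\<in>I. (\<Sum>j\<in>J. g i j * v j) = 0) \<and> (\<Sum>j\<in>J. w j * v j) \<noteq> 0)"
  using assms(1)
proof (induction I arbitrary: w rule: finite_induct)
  case empty
  show ?case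
  proof (cases "\<forall>j\<in>J. w j = 0")
    case False
    then obtain j where j: "j \<in> J" "w j \<noteq> 0" by auto
    have "(\<Sum>i\<in>J. w i * (if i = j then 1 else 0)) = w j"
      using j assms(2) by (simp add: if_distrib cong: if_cong)
    then show ?thesis using j by (intro disjI2 exI[of _ "\<lambda>i. if i = j then 1 else 0"]) auto
  qed auto
next
  case (insert k I)
  let ?span = "\<lambda>w. \<exists>c. \<forall>j\<in>J. w j = (\<Sum>i\<in>I. c i * g i j)"
  let ?dot = "\<lambda>w v. \<Sum>j\<in>J. w j * v j"
  have ext: "\<exists>c. \<forall>j\<in>J. w j = (\<Sum>i\<in>insert k I. c i * g i j)" if "?span (\<lambda>j. w j - t * g k j)" for t
  proof -
    from that obtain c where c: "\<And>j. j \<in> J \<Longrightarrow> w j - t * g k j = (\<Sum>i\<in>I. c i * g i j)" by blast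
    have "w j = (\<Sum>i\<in>insert k I. (c(k := t)) i * g i j)" if "j \<in> J" for j
    proof -
      have "(\<Sum>i\<in>I. (c(k := t)) i * g i j) = (\<Sum>i\<in>I. c i * g i j)"
        using insert.hyps by (intro sum.cong) auto
      then show ?thesis using c[OF that] insert.hyps by (simp add: algebra_simps)
    qed
    then show ?thesis by blast
  qed
  show ?case
  proof (cases "?span w")
    case True
    then show ?thesis using ext[of 0] by simp
  next
    case False
    then obtain v where v: "\<forall>i\<in>I. ?dot (g i) v = 0" "?dot w v \<noteq> 0"
      using insert.IH by blast
    show ?thesis
    proof (cases "?dot (g k) v = 0")
      case True
      then show ?thesis using v by blast
    next
      case gv: False
      \<comment> \<open>With this \<open>t\<close> the functional \<open>v\<close> kills
        \<open>w - t * g k\<close>. If that vector is again outside the span of the old family, the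
        induction hypothesis gives a second functional \<open>u\<close>.\<close>
      define t where "t = ?dot w v / ?dot (g k) v"
      show ?thesis
      proof (cases "?span (\<lambda>j. w j - t * g k j)")
        case True
        then show ?thesis using ext by blast
      next
        case False
        then obtain u where u: "\<forall>i\<in>I. ?dot (g i) u = 0" "?dot (\<lambda>j. w j - t * g k j) u \<noteq> 0"
          using insert.IH[of "\<lambda>j. w j - t * g k j"] by blast
        \<comment> \<open>Correcting \<open>u\<close> by \<open>s * v\<close> kills
          \<open>g k\<close> too. The value at \<open>w\<close> becomes the value of
          \<open>u\<close> at \<open>w - t * g k\<close>, which is nonzero.\<close>
        define s where "s = ?dot (g k) u / ?dot (g k) v"
        have lin: "?dot h (\<lambda>j. u j - s * v j) = ?dot h u - s * ?dot h v" for h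
          by (simp add: algebra_simps sum_subtractf sum_distrib_left)
        have "?dot (g k) (\<lambda>j. u j - s * v j) = 0"
          using gv by (simp only: lin) (simp add: s_def)
        moreover have "?dot (\<lambda>j. w j - t * g k j) u = ?dot w u - t * ?dot (g k) u"
          by (simp add: algebra_simps sum_subtractf sum_distrib_left)
        then have "?dot w (\<lambda>j. u j - s * v j) \<noteq> 0"
          using u(2) gv by (simp only: lin) (simp add: s_def t_def mult.commute)
        moreover have "\<forall>i\<in>I. ?dot (g i) (\<lambda>j. u j - s * v j) = 0"
          using u(1) v(1) by (simp add: lin)
        ultimately show ?thesis
          by (intro disjI2 exI[of _ "\<lambda>j. u j - s * v j"]) auto
      qed
    qed
  qed
qed

section \<open>Rows and entries selected by a set of positions\<close>

lemma dim_subrows [simp]: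
  "dim_row (subrows A I) = card {i. i < dim_row A \<and> i \<in> I}" "dim_col (subrows A I) = dim_col A"
  by (simp_all add: subrows_def dim_submatrix)

lemma dim_subvec [simp]: "dim_vec (subvec v I) = card {i. i < dim_vec v \<and> i \<in> I}"
  by (simp add: subvec_def)

text \<open>Submatrices renumber the selected rows by \<open>pick\<close>. This lemma and the next
  one translate between new and original numbers when only the part of \<open>I\<close> below
  \<open>z\<close> matters.\<close>

lemma pick_bounded:
  assumes "k < card {i. i < z \<and> i \<in> I}"
  shows "pick I k < z" "pick I k \<in> I"
proof -
  show "pick I k < z" using pick_le[OF assms] .
  have "pick {i. i < z \<and> i \<in> I} k \<in> {i. i < z \<and> i \<in> I}" using assms by (intro pick_in_set) simp
  then show "pick I k \<in> I" using pick_reduce_set[OF assms] by simp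
qed

lemma pick_bounded_surj:
  assumes "i < z" "i \<in> I"
  obtains k where "k < card {i. i < z \<and> i \<in> I}" "pick I k = i"
proof
  show "card {a \<in> I. a < i} < card {i. i < z \<and> i \<in> I}"
    using assms by (intro psubset_card_mono) auto
  show "pick I (card {a \<in> I. a < i}) = i" using assms(2) by (rule pick_card_in_set)
qed

lemma row_subrows:
  assumes "k < card {i. i < dim_row A \<and> i \<in> I}"
  shows "row (subrows A I) k = row A (pick I k)"
  using pick_bounded[OF assms] assms
  by (intro eq_vecI) (simp_all add: subrows_def submatrix_def pick_UNIV)

lemma subrows_mult_vec: "subrows A I *\<^sub>v v = subvec (A *\<^sub>v v) I"
proof (rule eq_vecI)
  fix k assume "k < dim_vec (subvec (A *\<^sub>v v) I)"
  then have k: "k < card {i. i < dim_row A \<and> i \<in> I}" by simp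
  then show "(subrows A I *\<^sub>v v) $ k = subvec (A *\<^sub>v v) I $ k"
    using pick_bounded[OF k] by (simp add: row_subrows subvec_def)
qed simp

lemma subvec_add:
  assumes "dim_vec v = dim_vec w"
  shows "subvec v I + subvec w I = subvec (v + w) I"
proof (rule eq_vecI)
  fix k assume "k < dim_vec (subvec (v + w) I)"
  then have k: "k < card {i. i < dim_vec w \<and> i \<in> I}" by simp
  then show "(subvec v I + subvec w I) $ k = subvec (v + w) I $ k"
    using pick_bounded[OF k] assms by (simp add: subvec_def)
qed (use assms in simp)

text \<open>Removes the renumbering: comparing selected parts becomes comparing entries at their
  original positions, the form used in all later conditions.\<close>

lemma subvec_eq_iff:
  assumes "dim_vec v = z" "dim_vec w = z"
  shows "subvec v I = subvec w I \<longleftrightarrow> (\<forall>i\<in>I. i < z \<longrightarrow> v $ i = w $ i)"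
proof
  assume eq: "subvec v I = subvec w I"
  show "\<forall>i\<in>I. i < z \<longrightarrow> v $ i = w $ i"
  proof (intro ballI impI)
    fix i assume i: "i \<in> I" "i < z"
    then obtain k where k: "k < card {i. i < z \<and> i \<in> I}" "pick I k = i"
      by (elim pick_bounded_surj[rotated])
    then have "subvec v I $ k = v $ i" "subvec w I $ k = w $ i"
      using assms by (simp_all add: subvec_def)
    then show "v $ i = w $ i" using eq by simp
  qed
next
  assume "\<forall>i\<in>I. i < z \<longrightarrow> v $ i = w $ i"
  then show "subvec v I = subvec w I"
    using assms pick_bounded by (intro eq_vecI) (simp_all add: subvec_def)
qed

lemma subrows_eq_iff:
  assumes "A \<in> carrier_mat z m" "B \<in> carrier_mat z m"
  shows "subrows A I = subrows B I \<longleftrightarrow> (\<forall>i\<in>I. i < z \<longrightarrow> row A i = row B i)"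
proof
  assume eq: "subrows A I = subrows B I"
  show "\<forall>i\<in>I. i < z \<longrightarrow> row A i = row B i"
  proof (intro ballI impI)
    fix i assume i: "i \<in> I" "i < z"
    then obtain k where k: "k < card {i. i < z \<and> i \<in> I}" "pick I k = i"
      by (elim pick_bounded_surj[rotated])
    then have "row (subrows A I) k = row A i" "row (subrows B I) k = row B i"
      using assms by (auto simp: row_subrows)
    then show "row A i = row B i" using eq by simp
  qed
next
  assume *: "\<forall>i\<in>I. i < z \<longrightarrow> row A i = row B i"
  show "subrows A I = subrows B I"
  proof (rule eq_rowI)
    fix k assume "k < dim_row (subrows B I)"
    then have k: "k < card {i. i < z \<and> i \<in> I}" using assms by simp
    then show "row (subrows A I) k = row (subrows B I) k"
      using * pick_bounded[OF k] assms by (simp add: row_subrows)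
  qed (use assms in auto)
qed

text \<open>Vectors of dimension \<open>n\<close> correspond to lists of length \<open>n\<close>,
  whose number is known.\<close>

lemma card_carrier_vec: "card (carrier_vec n :: 'a::finite Matrix.vec set) = CARD('a) ^ n"
proof -
  let ?L = "{xs :: 'a list. set xs \<subseteq> UNIV \<and> length xs = n}"
  have "bij_betw vec_of_list ?L (carrier_vec n)"
  proof (rule bij_betw_byWitness[where f' = list_of_vec])
    show "\<forall>xs\<in>?L. list_of_vec (vec_of_list xs) = xs" by (intro ballI list_vec)
    show "\<forall>v\<in>carrier_vec n. vec_of_list (list_of_vec v) = v" by (intro ballI vec_list)
    show "vec_of_list ` ?L \<subseteq> carrier_vec n"
      by (intro image_subsetI carrier_vecI) simp
    show "list_of_vec ` carrier_vec n \<subseteq> ?L"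
      by (intro image_subsetI) (simp add: carrier_vecD)
  qed
  then have "card (carrier_vec n :: 'a Matrix.vec set) = card ?L"
    by (rule bij_betw_same_card[symmetric])
  also have "\<dots> = CARD('a) ^ n" by (rule card_lists_length_eq) simp
  finally show ?thesis .
qed

lemma finite_carrier_vec: "finite (carrier_vec n :: 'a::finite Matrix.vec set)"
  by (rule card_ge_0_finite) (simp add: card_carrier_vec)

lemma finite_carrier_mat: "finite (carrier_mat m n :: 'a::finite mat set)"
proof (rule finite_subset)
  show "carrier_mat m n \<subseteq> Matrix.mat m n ` (({..<m} \<times> {..<n}) \<rightarrow>\<^sub>E (UNIV :: 'a set))"
  proof
    fix A :: "'a mat" assume "A \<in> carrier_mat m n"
    then have "A = Matrix.mat m n (\<lambda>p\<in>{..<m} \<times> {..<n}. A $$ p)"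
      by (intro eq_matI) simp_all
    moreover have "(\<lambda>p\<in>{..<m} \<times> {..<n}. A $$ p) \<in> ({..<m} \<times> {..<n}) \<rightarrow>\<^sub>E UNIV"
      by (intro restrict_PiE_iff[THEN iffD2]) simp
    ultimately show "A \<in> Matrix.mat m n ` (({..<m} \<times> {..<n}) \<rightarrow>\<^sub>E UNIV)"
      by (rule image_eqI)
  qed
qed (auto intro!: finite_PiE)

lemma positions_subset: "positions z \<tau> X \<subseteq> {..<z}"
  by (auto simp: positions_def)

lemma sum_lessThan_add_split:
  "(\<Sum>j<x + y. f j) = (\<Sum>j<x. f j) + (\<Sum>j<y. f (x + j :: nat) :: 'a::comm_monoid_add)"
  by (induction y) (auto simp: add.assoc)

lemma index_mult_append_vec:
  assumes "G \<in> carrier_mat z (x + y)" "l \<in> carrier_vec x" "u \<in> carrier_vec y" "r < z"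
  shows "(G *\<^sub>v (l @\<^sub>v u)) $ r = (\<Sum>j<x. G $$ (r, j) * l $ j) + (\<Sum>j<y. G $$ (r, x + j) * u $ j)"
proof -
  have "(G *\<^sub>v (l @\<^sub>v u)) $ r = (\<Sum>j<x + y. G $$ (r, j) * (l @\<^sub>v u) $ j)"
    using assms by (simp add: scalar_prod_def atLeast0LessThan)
  also have "\<dots> = (\<Sum>j<x. G $$ (r, j) * (l @\<^sub>v u) $ j) + (\<Sum>j<y. G $$ (r, x + j) * (l @\<^sub>v u) $ (x + j))"
    by (rule sum_lessThan_add_split)
  also have "\<dots> = (\<Sum>j<x. G $$ (r, j) * l $ j) + (\<Sum>j<y. G $$ (r, x + j) * u $ j)"
    using assms by (intro arg_cong2[where f = "(+)"] sum.cong refl) auto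
  finally show ?thesis .
qed

section \<open>Row spaces and spans in coordinates, and their dual kernel conditions\<close>

lemma mem_row_space_subrows_iff:
  fixes G :: "'a::{field} mat"
  assumes G: "G \<in> carrier_mat z N" and I: "I \<subseteq> {..<z}"
  shows "w \<in> vec_space.row_space N (subrows G I) \<longleftrightarrow>
    w \<in> carrier_vec N \<and> (\<exists>c. \<forall>j<N. w $ j = (\<Sum>i\<in>I. c i * G $$ (i, j)))"
proof -
  have I': "{i. i < z \<and> i \<in> I} = I" using I by auto
  have finI: "finite I" using I finite_subset by blast
  have S: "subrows G I \<in> carrier_mat (card I) N" using G I' by (intro carrier_matI) auto
  \<comment> \<open>Coefficients of the submatrix are numbered by \<open>pick\<close>; this
    bijection moves them to the original rows, which is the shape of the alternative above.\<close>
  have bij: "bij_betw (pick I) {..<card I} I"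
  proof (rule bij_betw_imageI)
    show "inj_on (pick I) {..<card I}"
    proof (rule inj_onI)
      fix k m assume "k \<in> {..<card I}" "m \<in> {..<card I}" "pick I k = pick I m"
      then show "k = m"
        using pick_mono[of m I k] pick_mono[of k I m] by (cases k m rule: linorder_cases) auto
    qed
    show "pick I ` {..<card I} = I"
    proof
      show "pick I ` {..<card I} \<subseteq> I" using pick_bounded(2)[of _ z I] I' by auto
      show "I \<subseteq> pick I ` {..<card I}"
      proof
        fix i assume i: "i \<in> I"
        with I obtain k where "k < card {i. i < z \<and> i \<in> I}" "pick I k = i"
          using pick_bounded_surj[of i z I] by blast
        then show "i \<in> pick I ` {..<card I}" unfolding I' by blast
      qed
    qed
  qed
  have entry: "((subrows G I)\<^sup>T *\<^sub>v v) $ j = (\<Sum>k<card I. v $ k * G $$ (pick I k, j))"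
    if "v \<in> carrier_vec (card I)" "j < N" for v j
  proof -
    have "((subrows G I)\<^sup>T *\<^sub>v v) $ j = (\<Sum>k<card I. subrows G I $$ (k, j) * v $ k)"
      using carrier_matD[OF S] that by (simp add: scalar_prod_def atLeast0LessThan del: dim_subrows)
    also have "\<dots> = (\<Sum>k<card I. v $ k * G $$ (pick I k, j))"
      using G that I' by (intro sum.cong refl) (simp add: subrows_def submatrix_def pick_UNIV mult.commute)
    finally show ?thesis .
  qed
  interpret vec_space "TYPE('a)" N .
  have "w \<in> row_space (subrows G I) \<longleftrightarrow>
      w \<in> carrier_vec N \<and> (\<exists>v\<in>carrier_vec (card I). (subrows G I)\<^sup>T *\<^sub>v v = w)"
    unfolding row_space_eq[OF S] carrier_matD[OF S] by blast
  also have "\<dots> \<longleftrightarrow> w \<in> carrier_vec N \<and> (\<exists>c. \<forall>j<N. w $ j = (\<Sum>i\<in>I. c i * G $$ (i, j)))"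
  proof (intro conj_cong refl iffI)
    assume "\<exists>v\<in>carrier_vec (card I). (subrows G I)\<^sup>T *\<^sub>v v = w"
    then obtain v where v: "v \<in> carrier_vec (card I)" "(subrows G I)\<^sup>T *\<^sub>v v = w" by blast
    define c where "c i = v $ the_inv_into {..<card I} (pick I) i" for i
    have "w $ j = (\<Sum>i\<in>I. c i * G $$ (i, j))" if "j < N" for j
    proof -
      have "(\<Sum>i\<in>I. c i * G $$ (i, j)) = (\<Sum>k<card I. c (pick I k) * G $$ (pick I k, j))"
        by (rule sum.reindex_bij_betw[OF bij, symmetric])
      also have "\<dots> = (\<Sum>k<card I. v $ k * G $$ (pick I k, j))"
        using bij by (intro sum.cong refl) (simp add: c_def the_inv_into_f_f bij_betw_def)
      finally show ?thesis using entry[OF v(1) that] v(2) by simp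
    qed
    then show "\<exists>c. \<forall>j<N. w $ j = (\<Sum>i\<in>I. c i * G $$ (i, j))" by blast
  next
    assume w: "w \<in> carrier_vec N" and "\<exists>c. \<forall>j<N. w $ j = (\<Sum>i\<in>I. c i * G $$ (i, j))"
    then obtain c where c: "\<And>j. j < N \<Longrightarrow> w $ j = (\<Sum>i\<in>I. c i * G $$ (i, j))" by blast
    let ?v = "Matrix.vec (card I) (\<lambda>k. c (pick I k))"
    have "(subrows G I)\<^sup>T *\<^sub>v ?v = w"
    proof (rule eq_vecI)
      fix j assume "j < dim_vec w"
      then have j: "j < N" using w by simp
      have "w $ j = (\<Sum>k<card I. c (pick I k) * G $$ (pick I k, j))"
        unfolding c[OF j] by (rule sum.reindex_bij_betw[OF bij, symmetric])
      then show "((subrows G I)\<^sup>T *\<^sub>v ?v) $ j = w $ j"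
        using entry[of ?v, OF _ j] by simp
    qed (use G w in simp)
    then show "\<exists>v\<in>carrier_vec (card I). (subrows G I)\<^sup>T *\<^sub>v v = w"
      by (intro bexI[of _ ?v]) simp_all
  qed
  finally show ?thesis .
qed

text \<open>A linear combination here is taken over a set of vectors. Since distinct indices give
  distinct unit vectors, it can be reindexed by coordinates and its coefficients read off.\<close>

lemma mem_span_target_vectors_iff:
  fixes w :: "'a::field Matrix.vec"
  shows "w \<in> LinearCombinations.module.span class_ring (module_vec TYPE('a) (x + y)) (target_vectors x y)
    \<longleftrightarrow> w \<in> carrier_vec (x + y) \<and> (\<forall>j<y. w $ (x + j) = 0)"
proof -
  interpret vec_space "TYPE('a)" "x + y" .
  have E: "target_vectors x y = unit_vec (x + y) ` {..<x}"
    unfolding target_vectors_def by auto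
  have carr: "unit_vec (x + y) ` {..<x} \<subseteq> carrier_vec (x + y)" by auto
  have inj: "inj_on (unit_vec (x + y) :: nat \<Rightarrow> 'a Matrix.vec) {..<x}"
    by (intro inj_onI) (auto simp: unit_vec_eq)
  have idx: "lincomb a (unit_vec (x + y) ` {..<x}) $ j = (if j < x then a (unit_vec (x + y) j) else 0)"
    if "j < x + y" for a j
  proof -
    have "lincomb a (unit_vec (x + y) ` {..<x}) $ j = (\<Sum>i<x. a (unit_vec (x + y) i) * unit_vec (x + y) i $ j)"
      unfolding lincomb_index[OF that carr] by (simp only: sum.reindex[OF inj] comp_def)
    also have "\<dots> = (\<Sum>i<x. if i = j then a (unit_vec (x + y) i) else 0)"
      using that by (intro sum.cong refl) (auto simp: unit_vec_def)
    finally show ?thesis by simp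
  qed
  have dim: "lincomb a (unit_vec (x + y) ` {..<x}) \<in> carrier_vec (x + y)" for a
    using carr by (intro lincomb_closed) auto
  have "w \<in> span (target_vectors x y) \<longleftrightarrow> (\<exists>a. w = lincomb a (unit_vec (x + y) ` {..<x}))"
    unfolding E using finite_span[OF _ carr] by auto
  also have "\<dots> \<longleftrightarrow> w \<in> carrier_vec (x + y) \<and> (\<forall>j<y. w $ (x + j) = 0)"
  proof
    assume "\<exists>a. w = lincomb a (unit_vec (x + y) ` {..<x})"
    then show "w \<in> carrier_vec (x + y) \<and> (\<forall>j<y. w $ (x + j) = 0)" using idx dim by auto
  next
    assume w: "w \<in> carrier_vec (x + y) \<and> (\<forall>j<y. w $ (x + j) = 0)"
    \<comment> \<open>Coefficients are attached to vectors, so the coordinate belonging to a unit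
      vector is found by inverting \<open>unit_vec\<close>.\<close>
    define a where "a v = w $ the_inv_into {..<x} (unit_vec (x + y)) v" for v :: "'a Matrix.vec"
    have "w = lincomb a (unit_vec (x + y) ` {..<x})"
    proof (rule eq_vecI)
      fix j assume "j < dim_vec (lincomb a (unit_vec (x + y) ` {..<x}))"
      then have j: "j < x + y" using carrier_vecD[OF dim] by metis
      show "w $ j = lincomb a (unit_vec (x + y) ` {..<x}) $ j"
      proof (cases "j < x")
        case True
        then show ?thesis using j by (simp add: idx a_def the_inv_into_f_f[OF inj])
      next
        case False
        then have "j = x + (j - x)" "j - x < y" using j by auto
        then have "w $ j = 0" using w by metis
        then show ?thesis using False j by (simp add: idx)
      qed
    qed (simp only: carrier_vecD[OF dim] carrier_vecD[OF conjunct1[OF w]])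
    then show "\<exists>a. w = lincomb a (unit_vec (x + y) ` {..<x})" by blast
  qed
  finally show ?thesis .
qed

text \<open>The hub of all equivalences, free of spans and probabilities. Kernels suffice because,
  by linearity, two inputs with equal shares differ by a kernel vector: the secret part of the
  kernel is zero on authorised sets and arbitrary on forbidden ones.\<close>

definition sharing_matrix ::
  "nat set set \<Rightarrow> nat set set \<Rightarrow> nat \<Rightarrow> nat \<Rightarrow> nat \<Rightarrow> 'a::field mat \<Rightarrow> (nat \<Rightarrow> nat) \<Rightarrow> bool" where
  "sharing_matrix \<AA> \<BB> x y z G \<tau> \<longleftrightarrow>
     G \<in> carrier_mat z (x + y) \<and>
     (\<forall>A\<in>\<AA>. \<forall>l\<in>carrier_vec x. \<forall>u\<in>carrier_vec y.
        (\<forall>i\<in>positions z \<tau> A. (G *\<^sub>v (l @\<^sub>v u)) $ i = 0) \<longrightarrow> l = 0\<^sub>v x) \<and>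
     (\<forall>B\<in>\<BB>. \<forall>l\<in>carrier_vec x. \<exists>u\<in>carrier_vec y.
        \<forall>i\<in>positions z \<tau> B. (G *\<^sub>v (l @\<^sub>v u)) $ i = 0)"

text \<open>The row space consists of the vectors orthogonal to the kernel, so
  \<open>unit_vec (x + y) k\<close> lies in it exactly when every kernel vector has
  \<open>k\<close>-th coordinate 0.\<close>

lemma target_vectors_subset_row_space_iff:
  fixes G :: "'a::field mat"
  assumes G: "G \<in> carrier_mat z (x + y)" and I: "I \<subseteq> {..<z}"
  shows "target_vectors x y \<subseteq> vec_space.row_space (x + y) (subrows G I) \<longleftrightarrow>
    (\<forall>l\<in>carrier_vec x. \<forall>u\<in>carrier_vec y. (\<forall>i\<in>I. (G *\<^sub>v (l @\<^sub>v u)) $ i = 0) \<longrightarrow> l = 0\<^sub>v x)"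
proof
  assume sub: "target_vectors x y \<subseteq> vec_space.row_space (x + y) (subrows G I)"
  show "\<forall>l\<in>carrier_vec x. \<forall>u\<in>carrier_vec y. (\<forall>i\<in>I. (G *\<^sub>v (l @\<^sub>v u)) $ i = 0) \<longrightarrow> l = 0\<^sub>v x"
  proof (intro ballI impI)
    fix l u :: "'a Matrix.vec"
    assume l: "l \<in> carrier_vec x" and u: "u \<in> carrier_vec y"
      and z: "\<forall>i\<in>I. (G *\<^sub>v (l @\<^sub>v u)) $ i = 0"
    have "l $ k = 0" if k: "k < x" for k
    proof -
      have "unit_vec (x + y) k \<in> vec_space.row_space (x + y) (subrows G I)"
        using sub k unfolding target_vectors_def by blast
      then obtain c where c: "\<And>j. j < x + y \<Longrightarrow> unit_vec (x + y) k $ j = (\<Sum>i\<in>I. c i * G $$ (i, j))"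
        unfolding mem_row_space_subrows_iff[OF G I] by blast
      have "l $ k = (\<Sum>j<x + y. unit_vec (x + y) k $ j * (l @\<^sub>v u) $ j)"
      proof -
        have "(\<Sum>j<x + y. unit_vec (x + y) k $ j * (l @\<^sub>v u) $ j)
            = (\<Sum>j<x + y. if j = k then (l @\<^sub>v u) $ j else 0)"
          using k by (intro sum.cong refl) (simp add: unit_vec_def)
        then show ?thesis using k l u by simp
      qed
      also have "\<dots> = (\<Sum>j<x + y. \<Sum>i\<in>I. c i * (G $$ (i, j) * (l @\<^sub>v u) $ j))"
        by (intro sum.cong refl) (simp add: c sum_distrib_right mult.assoc)
      also have "\<dots> = (\<Sum>i\<in>I. c i * (\<Sum>j<x + y. G $$ (i, j) * (l @\<^sub>v u) $ j))"
        by (subst sum.swap) (simp add: sum_distrib_left)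
      also have "\<dots> = (\<Sum>i\<in>I. c i * (G *\<^sub>v (l @\<^sub>v u)) $ i)"
      proof (intro sum.cong refl)
        fix i assume "i \<in> I"
        then have "i < z" using I by auto
        then show "c i * (\<Sum>j<x + y. G $$ (i, j) * (l @\<^sub>v u) $ j) = c i * (G *\<^sub>v (l @\<^sub>v u)) $ i"
          using G l u by (simp add: scalar_prod_def atLeast0LessThan)
      qed
      also have "\<dots> = 0" using z by (intro sum.neutral) simp
      finally show ?thesis .
    qed
    then show "l = 0\<^sub>v x" using l by (intro eq_vecI) auto
  qed
next
  assume ker: "\<forall>l\<in>carrier_vec x. \<forall>u\<in>carrier_vec y. (\<forall>i\<in>I. (G *\<^sub>v (l @\<^sub>v u)) $ i = 0) \<longrightarrow> l = 0\<^sub>v x"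
  have finI: "finite I" using I finite_subset by blast
  have "unit_vec (x + y) k \<in> vec_space.row_space (x + y) (subrows G I)" if k: "k < x" for k
  proof -
    have "\<not> (\<exists>v. (\<forall>i\<in>I. (\<Sum>j<x + y. G $$ (i, j) * v j) = 0) \<and>
        (\<Sum>j<x + y. unit_vec (x + y) k $ j * v j) \<noteq> 0)"
    proof
      assume "\<exists>v. (\<forall>i\<in>I. (\<Sum>j<x + y. G $$ (i, j) * v j) = 0) \<and>
        (\<Sum>j<x + y. unit_vec (x + y) k $ j * v j) \<noteq> 0"
      then obtain v where v: "\<And>i. i \<in> I \<Longrightarrow> (\<Sum>j<x + y. G $$ (i, j) * v j) = 0"
        "(\<Sum>j<x + y. unit_vec (x + y) k $ j * v j) \<noteq> 0" by blast
      \<comment> \<open>The separating functional, cut into secret and seed, is a kernel vector; its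
        secret part must vanish, although its \<open>k\<close>-th entry is nonzero.\<close>
      let ?l = "Matrix.vec x v" and ?u = "Matrix.vec y (\<lambda>j. v (x + j))"
      have "(G *\<^sub>v (?l @\<^sub>v ?u)) $ i = 0" if "i \<in> I" for i
      proof -
        have "i < z" using that I by auto
        then have "(G *\<^sub>v (?l @\<^sub>v ?u)) $ i = (\<Sum>j<x. G $$ (i, j) * v j) + (\<Sum>j<y. G $$ (i, x + j) * v (x + j))"
          by (subst index_mult_append_vec[OF G]) auto
        then show ?thesis using v(1)[OF that] by (simp add: sum_lessThan_add_split)
      qed
      then have "?l = 0\<^sub>v x" by (intro ker[rule_format]) auto
      then have "v k = 0" using k by (metis index_vec index_zero_vec(1))
      moreover have "(\<Sum>j<x + y. unit_vec (x + y) k $ j * v j) = (\<Sum>j<x + y. if j = k then v j else 0)"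
        using k by (intro sum.cong refl) (simp add: unit_vec_def)
      ultimately show False using v(2) k by simp
    qed
    then have "\<exists>c. \<forall>j\<in>{..<x + y}. unit_vec (x + y) k $ j = (\<Sum>i\<in>I. c i * G $$ (i, j))"
      using combination_or_separating_functional[OF finI finite_lessThan,
          where g = "\<lambda>i j. G $$ (i, j)" and w = "\<lambda>j. unit_vec (x + y) k $ j"] by blast
    then show ?thesis unfolding mem_row_space_subrows_iff[OF G I] by auto
  qed
  then show "target_vectors x y \<subseteq> vec_space.row_space (x + y) (subrows G I)"
    unfolding target_vectors_def by blast
qed

text \<open>Finding \<open>u\<close> for a given \<open>l\<close> means solving a linear system in
  the last \<open>y\<close> columns. An obstruction to solving it is a combination of rows that
  vanishes on those columns but not on \<open>l\<close>, hence a nonzero element of the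
  intersection.\<close>

lemma span_target_vectors_Int_row_space_iff:
  fixes G :: "'a::field mat"
  assumes G: "G \<in> carrier_mat z (x + y)" and I: "I \<subseteq> {..<z}"
  shows "LinearCombinations.module.span class_ring (module_vec TYPE('a) (x + y)) (target_vectors x y) \<inter>
      vec_space.row_space (x + y) (subrows G I) = {0\<^sub>v (x + y)} \<longleftrightarrow>
    (\<forall>l\<in>carrier_vec x. \<exists>u\<in>carrier_vec y. \<forall>i\<in>I. (G *\<^sub>v (l @\<^sub>v u)) $ i = 0)"
    (is "?S \<inter> ?R = _ \<longleftrightarrow> _")
proof
  assume triv: "?S \<inter> ?R = {0\<^sub>v (x + y)}"
  have finI: "finite I" using I finite_subset by blast
  show "\<forall>l\<in>carrier_vec x. \<exists>u\<in>carrier_vec y. \<forall>i\<in>I. (G *\<^sub>v (l @\<^sub>v u)) $ i = 0"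
  proof
    fix l :: "'a Matrix.vec" assume l: "l \<in> carrier_vec x"
    \<comment> \<open>The right-hand side of the system for the seed: the contribution of
      \<open>l\<close>, moved across.\<close>
    define b where "b i = - (\<Sum>j<x. G $$ (i, j) * l $ j)" for i
    have "\<not> (\<exists>v. (\<forall>k\<in>{..<y}. (\<Sum>i\<in>I. G $$ (i, x + k) * v i) = 0) \<and> (\<Sum>i\<in>I. b i * v i) \<noteq> 0)"
    proof
      assume "\<exists>v. (\<forall>k\<in>{..<y}. (\<Sum>i\<in>I. G $$ (i, x + k) * v i) = 0) \<and> (\<Sum>i\<in>I. b i * v i) \<noteq> 0"
      then obtain v where v: "\<And>k. k < y \<Longrightarrow> (\<Sum>i\<in>I. G $$ (i, x + k) * v i) = 0"
        "(\<Sum>i\<in>I. b i * v i) \<noteq> 0" by blast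
      \<comment> \<open>The obstruction \<open>v\<close>, read as coefficients of rows. It kills the
        seed columns, so the resulting row lies in the span of the targets.\<close>
      define w where "w = Matrix.vec (x + y) (\<lambda>j. \<Sum>i\<in>I. v i * G $$ (i, j))"
      have "w \<in> ?S"
        unfolding mem_span_target_vectors_iff using v(1) by (simp add: w_def mult.commute)
      moreover have "w \<in> ?R"
        unfolding mem_row_space_subrows_iff[OF G I] by (auto simp: w_def)
      ultimately have "w = 0\<^sub>v (x + y)" using triv by blast
      then have w0: "(\<Sum>i\<in>I. v i * G $$ (i, j)) = 0" if "j < x" for j
      proof -
        have "w $ j = 0" using \<open>w = 0\<^sub>v (x + y)\<close> that by simp
        then show ?thesis using that by (simp add: w_def)
      qed
      have "(\<Sum>i\<in>I. b i * v i) = - (\<Sum>i\<in>I. \<Sum>j<x. l $ j * (v i * G $$ (i, j)))"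
        unfolding b_def by (simp add: sum_negf sum_distrib_left algebra_simps)
      also have "\<dots> = - (\<Sum>j<x. l $ j * (\<Sum>i\<in>I. v i * G $$ (i, j)))"
        by (subst sum.swap) (simp add: sum_distrib_left)
      also have "\<dots> = 0" using w0 by simp
      finally show False using v(2) by simp
    qed
    then have "\<exists>c. \<forall>i\<in>I. b i = (\<Sum>k\<in>{..<y}. c k * G $$ (i, x + k))"
      using combination_or_separating_functional[OF finite_lessThan finI,
          where g = "\<lambda>k i. G $$ (i, x + k)" and w = b] by blast
    then obtain c where c: "\<And>i. i \<in> I \<Longrightarrow> b i = (\<Sum>k<y. c k * G $$ (i, x + k))" by blast
    have "(G *\<^sub>v (l @\<^sub>v Matrix.vec y c)) $ i = 0" if "i \<in> I" for i
    proof -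
      have "i < z" using that I by auto
      then have "(G *\<^sub>v (l @\<^sub>v Matrix.vec y c)) $ i = - b i + (\<Sum>k<y. c k * G $$ (i, x + k))"
        by (subst index_mult_append_vec[OF G l]) (auto simp: b_def mult.commute)
      then show ?thesis using c[OF that] by simp
    qed
    then show "\<exists>u\<in>carrier_vec y. \<forall>i\<in>I. (G *\<^sub>v (l @\<^sub>v u)) $ i = 0"
      by (intro bexI[of _ "Matrix.vec y c"]) auto
  qed
next
  assume ex: "\<forall>l\<in>carrier_vec x. \<exists>u\<in>carrier_vec y. \<forall>i\<in>I. (G *\<^sub>v (l @\<^sub>v u)) $ i = 0"
  have "w = 0\<^sub>v (x + y)" if "w \<in> ?S" "w \<in> ?R" for w
  proof -
    have w: "w \<in> carrier_vec (x + y)" "\<And>j. j < y \<Longrightarrow> w $ (x + j) = 0"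
      using that(1) unfolding mem_span_target_vectors_iff by simp_all
    have "\<exists>c. \<forall>j<x + y. w $ j = (\<Sum>i\<in>I. c i * G $$ (i, j))"
      using that(2) unfolding mem_row_space_subrows_iff[OF G I] by (rule conjunct2)
    then obtain c where c: "\<And>j. j < x + y \<Longrightarrow> w $ j = (\<Sum>i\<in>I. c i * G $$ (i, j))"
      by blast
    have w0: "w $ k = 0" if k: "k < x" for k
    proof -
      \<comment> \<open>Pairing \<open>w\<close> with this kernel vector gives 0, because
        \<open>w\<close> is a combination of rows; it also gives \<open>w $ k\<close>, because the
        last \<open>y\<close> entries of \<open>w\<close> vanish.\<close>
      obtain u where u: "u \<in> carrier_vec y" "\<And>i. i \<in> I \<Longrightarrow> (G *\<^sub>v (unit_vec x k @\<^sub>v u)) $ i = 0"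
        using ex[rule_format, of "unit_vec x k"] by auto
      have "0 = (\<Sum>i\<in>I. c i * (G *\<^sub>v (unit_vec x k @\<^sub>v u)) $ i)"
        using u(2) by simp
      also have "\<dots> = (\<Sum>i\<in>I. \<Sum>j<x + y. c i * G $$ (i, j) * (unit_vec x k @\<^sub>v u) $ j)"
      proof (intro sum.cong refl)
        fix i assume "i \<in> I"
        then have "i < z" using I by auto
        then show "c i * (G *\<^sub>v (unit_vec x k @\<^sub>v u)) $ i
            = (\<Sum>j<x + y. c i * G $$ (i, j) * (unit_vec x k @\<^sub>v u) $ j)"
          using G u(1) by (simp add: scalar_prod_def atLeast0LessThan sum_distrib_left mult.assoc)
      qed
      also have "\<dots> = (\<Sum>j<x + y. w $ j * (unit_vec x k @\<^sub>v u) $ j)"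
        by (subst sum.swap) (simp add: c sum_distrib_right)
      also have "\<dots> = (\<Sum>j<x. w $ j * unit_vec x k $ j)"
        unfolding sum_lessThan_add_split using u(1) w(2) by simp
      also have "\<dots> = (\<Sum>j<x. if j = k then w $ j else 0)"
        using k by (intro sum.cong refl) (simp add: unit_vec_def)
      also have "\<dots> = w $ k" using k by simp
      finally show ?thesis by simp
    qed
    show ?thesis
    proof (rule eq_vecI)
      fix j assume "j < dim_vec (0\<^sub>v (x + y))"
      then have j: "j < x + y" by simp
      show "w $ j = 0\<^sub>v (x + y) $ j"
        using w0[of j] w(2)[of "j - x"] j by (cases "j < x") auto
    qed (use w in simp)
  qed
  moreover have "0\<^sub>v (x + y) \<in> ?S" unfolding mem_span_target_vectors_iff by simp
  moreover have "0\<^sub>v (x + y) \<in> ?R"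
    unfolding mem_row_space_subrows_iff[OF G I] by (auto intro!: exI[of _ "\<lambda>_. 0"])
  ultimately show "?S \<inter> ?R = {0\<^sub>v (x + y)}" by blast
qed

lemma mmsp_iff_sharing_matrix: "mmsp \<AA> \<BB> x y z G \<tau> \<longleftrightarrow> sharing_matrix \<AA> \<BB> x y z G \<tau>"
proof (cases "G \<in> carrier_mat z (x + y)")
  case True
  show ?thesis
    unfolding mmsp_def sharing_matrix_def target_vectors_subset_row_space_iff[OF True positions_subset]
      span_target_vectors_Int_row_space_iff[OF True positions_subset] ..
qed (simp add: mmsp_def sharing_matrix_def)

section \<open>Secret sharing\<close>

lemma linear_map_module_vec_eq_mult_mat_vec:
  fixes \<psi> :: "'a::field Matrix.vec \<Rightarrow> 'a Matrix.vec"
  assumes "linear_map class_ring (module_vec TYPE('a) N) (module_vec TYPE('a) z) \<psi>"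
  obtains G where "G \<in> carrier_mat z N" "\<And>v. v \<in> carrier_vec N \<Longrightarrow> \<psi> v = G *\<^sub>v v"
proof -
  interpret L: linear_map class_ring "module_vec TYPE('a) N" "module_vec TYPE('a) z" \<psi>
    by fact
  have hom: "\<psi> \<in> module_hom class_ring (module_vec TYPE('a) N) (module_vec TYPE('a) z)"
    by (rule L.f_hom)
  have carr: "\<psi> v \<in> carrier_vec z" if "v \<in> carrier_vec N" for v
    using hom that unfolding module_hom_def module_vec_simps by blast
  have add: "\<psi> (v + w) = \<psi> v + \<psi> w" if "v \<in> carrier_vec N" "w \<in> carrier_vec N" for v w
    using hom that unfolding module_hom_def module_vec_simps by blast
  have scale: "\<psi> (c \<cdot>\<^sub>v v) = c \<cdot>\<^sub>v \<psi> v" if "v \<in> carrier_vec N" for c v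
    using hom that unfolding module_hom_def module_vec_simps by simp
  define G where "G = Matrix.mat z N (\<lambda>(i, j). \<psi> (unit_vec N j) $ i)"
  have G: "G \<in> carrier_mat z N" by (simp add: G_def)
  have unit: "G *\<^sub>v unit_vec N k = \<psi> (unit_vec N k)" if "k < N" for k
  proof (rule eq_vecI)
    have c: "\<psi> (unit_vec N k) \<in> carrier_vec z" by (rule carr) simp
    then show "dim_vec (G *\<^sub>v unit_vec N k) = dim_vec (\<psi> (unit_vec N k))"
      using G by simp
    fix i assume "i < dim_vec (\<psi> (unit_vec N k))"
    then have "i < z" using c by simp
    then show "(G *\<^sub>v unit_vec N k) $ i = \<psi> (unit_vec N k) $ i"
      using that by (simp add: G_def)
  qed
  \<comment> \<open>Induction on the length \<open>k\<close> of the initial segment that may carry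
    nonzero coordinates. This replaces expanding \<open>v\<close> as a finite sum in the
    module.\<close>
  have approx: "\<psi> v = G *\<^sub>v v" if "v \<in> carrier_vec N" "k \<le> N" "\<And>j. k \<le> j \<Longrightarrow> j < N \<Longrightarrow> v $ j = 0" for k v
    using that
  proof (induction k arbitrary: v)
    case 0
    \<comment> \<open>Writing the zero vector as a multiple of itself lets homogeneity show that
      \<psi> maps it to zero.\<close>
    have v: "v = 0 \<cdot>\<^sub>v v" using 0 by (intro eq_vecI) auto
    have "\<psi> v = 0 \<cdot>\<^sub>v \<psi> v" by (subst v) (rule scale[OF 0(1)])
    moreover have "G *\<^sub>v v = 0 \<cdot>\<^sub>v (G *\<^sub>v v)" by (subst v) (rule mult_mat_vec[OF G 0(1)])
    moreover have "0 \<cdot>\<^sub>v \<psi> v = 0 \<cdot>\<^sub>v (G *\<^sub>v v)"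
      using carr[OF 0(1)] G by (intro eq_vecI) auto
    ultimately show ?case by simp
  next
    case (Suc k)
    \<comment> \<open>Clearing coordinate \<open>k\<close> puts \<open>w\<close> within reach of the
      induction hypothesis; the removed part is a multiple of a basis vector.\<close>
    define w where "w = Matrix.vec N (\<lambda>j. if j < k then v $ j else 0)"
    have w: "w \<in> carrier_vec N" by (simp add: w_def)
    have e: "v $ k \<cdot>\<^sub>v unit_vec N k \<in> carrier_vec N" by simp
    have v: "v = w + v $ k \<cdot>\<^sub>v unit_vec N k"
    proof (rule eq_vecI)
      fix j assume "j < dim_vec (w + v $ k \<cdot>\<^sub>v unit_vec N k)"
      then have j: "j < N" by simp
      show "v $ j = (w + v $ k \<cdot>\<^sub>v unit_vec N k) $ j"
        using j Suc.prems(2) Suc.prems(3)[of j] by (cases j k rule: linorder_cases) (simp_all add: w_def)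
    qed (use Suc.prems in simp)
    have "\<psi> w = G *\<^sub>v w"
      using Suc.prems(2) by (intro Suc.IH w) (simp_all add: w_def)
    then have "\<psi> w + v $ k \<cdot>\<^sub>v \<psi> (unit_vec N k) = G *\<^sub>v w + v $ k \<cdot>\<^sub>v (G *\<^sub>v unit_vec N k)"
      using unit Suc.prems(2) by simp
    then have "\<psi> (w + v $ k \<cdot>\<^sub>v unit_vec N k) = G *\<^sub>v (w + v $ k \<cdot>\<^sub>v unit_vec N k)"
      by (simp add: add[OF w e] mult_add_distrib_mat_vec[OF G w e] scale mult_mat_vec[OF G])
    then show ?case using v by simp
  qed
  have "\<psi> v = G *\<^sub>v v" if "v \<in> carrier_vec N" for v
    by (rule approx[OF that le_refl]) simp
  with G that show ?thesis by blast
qed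

lemma linear_map_mult_mat_vec:
  fixes G :: "'a::field mat"
  assumes G: "G \<in> carrier_mat z N"
  shows "linear_map class_ring (module_vec TYPE('a) N) (module_vec TYPE('a) z) (\<lambda>v. G *\<^sub>v v)"
proof -
  interpret V: vec_space "TYPE('a)" N .
  interpret W: vec_space "TYPE('a)" z .
  show ?thesis
    by unfold_locales
      (use G in \<open>auto simp: module_hom_def module_vec_simps mult_add_distrib_mat_vec[OF G] mult_mat_vec[OF G]\<close>)
qed

section \<open>Blocks of positions, tuples of shares, and rates\<close>

lemma sum_card_positions:
  assumes "\<tau> \<in> {..<z} \<rightarrow> {..<n}"
  shows "(\<Sum>j<n. card (positions z \<tau> {j})) = z"
proof -
  have "(\<Union>j\<in>{..<n}. positions z \<tau> {j}) = {..<z}"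
    using assms by (auto simp: positions_def Pi_def)
  moreover have "(\<Sum>j<n. card (positions z \<tau> {j})) = card (\<Union>j\<in>{..<n}. positions z \<tau> {j})"
    by (intro card_UN_disjoint[symmetric]) (auto simp: positions_def)
  ultimately show ?thesis by simp
qed

lemma card_positions: "card {i. i < z \<and> i \<in> positions z \<tau> X} = card (positions z \<tau> X)"
  by (rule arg_cong[where f = card]) (auto simp: positions_def)

lemma subvec_positions_carrier:
  "v \<in> carrier_vec z \<Longrightarrow> subvec v (positions z \<tau> X) \<in> carrier_vec (card (positions z \<tau> X))"
  by (intro carrier_vecI) (simp add: card_positions)

lemma subrows_positions_carrier:
  "A \<in> carrier_mat z m \<Longrightarrow> subrows A (positions z \<tau> X) \<in> carrier_mat (card (positions z \<tau> X)) m"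
  by (intro carrier_matI) (auto simp: card_positions)

lemma positions_ball_iff: "(\<forall>j\<in>X. \<forall>i\<in>positions z \<tau> {j}. i < z \<longrightarrow> \<phi> i) \<longleftrightarrow> (\<forall>i\<in>positions z \<tau> X. \<phi> i)"
  by (auto simp: positions_def)

lemma restrict_eq_iff: "(\<lambda>j\<in>X. f j) = (\<lambda>j\<in>X. g j) \<longleftrightarrow> (\<forall>j\<in>X. f j = g j)"
  by (metis restrict_apply' restrict_ext)

text \<open>The joint view of a coalition \<open>X\<close> is a tuple of blocks, one per member. Its
  equality reduces to equality of entries over all positions that \<tau> assigns to
  \<open>X\<close>.\<close>

lemma restrict_subvec_positions_eq_iff:
  assumes "v \<in> carrier_vec z" "w \<in> carrier_vec z"
  shows "(\<lambda>j\<in>X. subvec v (positions z \<tau> {j})) = (\<lambda>j\<in>X. subvec w (positions z \<tau> {j})) \<longleftrightarrow>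
    (\<forall>i\<in>positions z \<tau> X. v $ i = w $ i)"
  unfolding restrict_eq_iff subvec_eq_iff[OF carrier_vecD[OF assms(1)] carrier_vecD[OF assms(2)]]
  by (rule positions_ball_iff)

lemma restrict_subrows_positions_eq_iff:
  assumes "A \<in> carrier_mat z m" "B \<in> carrier_mat z m"
  shows "(\<lambda>j\<in>X. subrows A (positions z \<tau> {j})) = (\<lambda>j\<in>X. subrows B (positions z \<tau> {j})) \<longleftrightarrow>
    (\<forall>i\<in>positions z \<tau> X. row A i = row B i)"
  unfolding restrict_eq_iff subrows_eq_iff[OF assms] by (rule positions_ball_iff)

lemma card_field_ge_2: "CARD('a::{field,finite}) \<ge> 2"
proof -
  have "card {0, 1 :: 'a} \<le> CARD('a)" by (intro card_mono) auto
  then show ?thesis by simp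
qed

lemma log_card_carrier_vec:
  "log 2 (card (carrier_vec m :: 'a::{field,finite} Matrix.vec set)) = m * log 2 CARD('a)"
  using card_field_ge_2[where 'a = 'a] by (simp add: card_carrier_vec log_nat_power)

lemma log_card_field_pos: "log 2 CARD('a::{field,finite}) > 0"
  using card_field_ge_2[where 'a = 'a] by simp

lemma sum_log_card_positions:
  assumes "\<tau> \<in> {..<z} \<rightarrow> {..<n}"
  shows "(\<Sum>j<n. log 2 (card (carrier_vec (card (positions z \<tau> {j})) :: 'a::{field,finite} Matrix.vec set)))
    = z * log 2 CARD('a)"
  unfolding log_card_carrier_vec
  by (simp only: sum_distrib_right[symmetric] of_nat_sum[symmetric] sum_card_positions[OF assms])

text \<open>The argument stays a function: a given linear \<psi> agrees with a matrix only on
  carrier vectors, so replacing it by the matrix could change the record.\<close>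

definition matrix_nss ::
    "nat \<Rightarrow> nat \<Rightarrow> nat \<Rightarrow> nat \<Rightarrow> (nat \<Rightarrow> nat) \<Rightarrow> ('a Matrix.vec \<Rightarrow> 'a Matrix.vec) \<Rightarrow>
     ('a Matrix.vec, 'a Matrix.vec, 'a Matrix.vec) nss" where
  "matrix_nss n x y z \<tau> \<psi> =
     \<lparr> secret_set = carrier_vec x,
       nss_seed_set = carrier_vec y,
       nss_share_set = (\<lambda>j. carrier_vec (card (positions z \<tau> {j}))),
       nss_share_map = (\<lambda>l u. \<lambda>j\<in>{..<n}. subvec (\<psi> (l @\<^sub>v u)) (positions z \<tau> {j})) \<rparr>"

lemma nss_rates:
  fixes \<psi> :: "'a::{field,finite} Matrix.vec \<Rightarrow> 'a Matrix.vec"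
  assumes "\<tau> \<in> {..<z} \<rightarrow> {..<n}"
  shows "ss_rate n (matrix_nss n x y z \<tau> \<psi>) = x / z"
    and "nss_randomness_rate (matrix_nss n x y z \<tau> \<psi>) = y / x"
proof -
  have ne: "log 2 CARD('a) \<noteq> 0" using log_card_field_pos[where 'a = 'a] by linarith
  show "ss_rate n (matrix_nss n x y z \<tau> \<psi>) = x / z"
    unfolding ss_rate_def matrix_nss_def nss.select_convs sum_log_card_positions[OF assms]
    unfolding log_card_carrier_vec by (rule mult_divide_mult_cancel_right[OF ne])
  show "nss_randomness_rate (matrix_nss n x y z \<tau> \<psi>) = y / x"
    unfolding nss_randomness_rate_def matrix_nss_def nss.select_convs
      log_card_carrier_vec by (rule mult_divide_mult_cancel_right[OF ne])
qed

lemma carrier_vec_nonempty: "carrier_vec m \<noteq> ({} :: 'a::zero Matrix.vec set)"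
  by (metis empty_iff zero_carrier_vec)

lemma zero_append_vec: "0\<^sub>v x @\<^sub>v 0\<^sub>v y = (0\<^sub>v (x + y) :: 'a::zero Matrix.vec)"
  by (intro eq_vecI) auto

lemma vec_add_right_cancel:
  fixes u u' d :: "'a::group_add Matrix.vec"
  assumes "u \<in> carrier_vec y" "u' \<in> carrier_vec y" "d \<in> carrier_vec y" "u + d = u' + d"
  shows "u = u'"
proof (rule eq_vecI)
  fix i assume "i < dim_vec u'"
  then have "i < y" using assms(2) by simp
  moreover have "(u + d) $ i = (u' + d) $ i" using assms(4) by simp
  ultimately show "u $ i = u' $ i" using assms(1-3) by simp
qed (use assms in simp)

lemma minus_append_vec:
  assumes "v \<in> carrier_vec x" "v' \<in> carrier_vec x" "w \<in> carrier_vec y" "w' \<in> carrier_vec y"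
  shows "(v @\<^sub>v w) - (v' @\<^sub>v w') = (v - v') @\<^sub>v (w - w' :: 'a::group_add Matrix.vec)"
  using assms by (intro eq_vecI) auto

text \<open>Replacing secret \<open>v'\<close> by \<open>v\<close> while shifting the seed by
  \<open>d\<close> changes the input by \<open>v - v'\<close> and \<open>d\<close>. Both privacy
  constructions choose \<open>d\<close> so that this change is invisible to
  \<open>B\<close>.\<close>

lemma append_vec_add_diff:
  fixes v v' w d :: "'a::ab_group_add Matrix.vec"
  assumes "v \<in> carrier_vec x" "v' \<in> carrier_vec x" "w \<in> carrier_vec y" "d \<in> carrier_vec y"
  shows "(v @\<^sub>v (w + d)) - (v' @\<^sub>v w) = (v - v') @\<^sub>v d"
proof -
  have "(w + d) - w = d" using assms(3,4) by (intro eq_vecI) simp_all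
  then show ?thesis
    using minus_append_vec[OF assms(1,2) add_carrier_vec[OF assms(3,4)] assms(3)] by simp
qed

lemma sharing_matrix_recover:
  assumes G: "sharing_matrix \<AA> \<BB> x y z G \<tau>" and A: "A \<in> \<AA>"
    and l: "l \<in> carrier_vec x" "l' \<in> carrier_vec x" and u: "u \<in> carrier_vec y" "u' \<in> carrier_vec y"
    and eq: "\<forall>i\<in>positions z \<tau> A. (G *\<^sub>v (l @\<^sub>v u)) $ i = (G *\<^sub>v (l' @\<^sub>v u')) $ i"
  shows "l = l'"
proof -
  have Gc: "G \<in> carrier_mat z (x + y)" using G by (simp add: sharing_matrix_def)
  have "G *\<^sub>v ((l - l') @\<^sub>v (u - u')) = G *\<^sub>v (l @\<^sub>v u) - G *\<^sub>v (l' @\<^sub>v u')"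
    using l u by (simp add: minus_append_vec[symmetric] mult_minus_distrib_mat_vec[OF Gc])
  then have "\<forall>i\<in>positions z \<tau> A. (G *\<^sub>v ((l - l') @\<^sub>v (u - u'))) $ i = 0"
    using eq Gc by (simp add: positions_def)
  moreover have "l - l' \<in> carrier_vec x" "u - u' \<in> carrier_vec y" using l u by auto
  ultimately have "l - l' = 0\<^sub>v x" using G A unfolding sharing_matrix_def by blast
  then have "(l - l') $ i = 0" if "i < x" for i using that by simp
  then show ?thesis using l by (intro eq_vecI) simp_all
qed

text \<open>From the protocol to the matrix, every input is compared with the zero input, whose
  shares are zero. In the other direction, the fibres over two secrets are matched by translating
  the seed.\<close>

lemma csnss_matrix_nss_iff:
  fixes \<psi> :: "'a::{field,finite} Matrix.vec \<Rightarrow> 'a Matrix.vec"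
  assumes acc: "access_structure n \<AA> \<BB>"
    and G: "G \<in> carrier_mat z (x + y)" and \<psi>: "\<And>v. v \<in> carrier_vec (x + y) \<Longrightarrow> \<psi> v = G *\<^sub>v v"
  shows "csnss \<AA> \<BB> n (matrix_nss n x y z \<tau> \<psi>) \<longleftrightarrow> sharing_matrix \<AA> \<BB> x y z G \<tau>"
proof -
  let ?P = "matrix_nss n x y z \<tau> \<psi>"
  let ?T = "carrier_vec x \<times> carrier_vec y :: ('a Matrix.vec \<times> 'a Matrix.vec) set"
  have Gv: "G *\<^sub>v (l @\<^sub>v u) \<in> carrier_vec z" if "l \<in> carrier_vec x" "u \<in> carrier_vec y" for l u
    using that G by auto
  have shares: "nss_shares ?P X (l, u) = (\<lambda>j\<in>X. subvec (G *\<^sub>v (l @\<^sub>v u)) (positions z \<tau> {j}))"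
    if "X \<subseteq> {..<n}" "l \<in> carrier_vec x" "u \<in> carrier_vec y" for X l u
    using that by (auto simp: nss_shares_def matrix_nss_def \<psi> intro!: restrict_ext)
  have shares_eq: "nss_shares ?P X (l, u) = nss_shares ?P X (l', u') \<longleftrightarrow>
      (\<forall>i\<in>positions z \<tau> X. (G *\<^sub>v (l @\<^sub>v u)) $ i = (G *\<^sub>v (l' @\<^sub>v u')) $ i)"
    if "X \<subseteq> {..<n}" "l \<in> carrier_vec x" "u \<in> carrier_vec y" "l' \<in> carrier_vec x" "u' \<in> carrier_vec y"
    for X l u l' u'
    using that by (simp add: shares restrict_subvec_positions_eq_iff Gv)
  have sub: "A \<subseteq> {..<n}" if "A \<in> \<AA> \<union> \<BB>" for A
    using acc that by (auto simp: access_structure_def)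
  have "nss_space ?P = uniform_count_measure ?T" by (simp add: nss_space_def matrix_nss_def)
  moreover have "finite ?T" by (simp add: finite_carrier_vec)
  moreover have "(0\<^sub>v x, 0\<^sub>v y) \<in> ?T" by simp
  ultimately have unif: "uniform_on (nss_space ?P) ?T"
    by (metis uniform_on_uniform_count_measure empty_iff)
  have prot: "nss_protocol n ?P"
    unfolding nss_protocol_def
    by (auto simp: matrix_nss_def finite_carrier_vec carrier_vec_nonempty \<psi> Gv intro!: subvec_positions_carrier)
  have dec: "ml_error (nss_space ?P) (secret_set ?P) (\<lambda>(L, U). L) (nss_shares ?P A) = 0 \<longleftrightarrow>
      (\<forall>l\<in>carrier_vec x. \<forall>u\<in>carrier_vec y. \<forall>l'\<in>carrier_vec x. \<forall>u'\<in>carrier_vec y.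
        (\<forall>i\<in>positions z \<tau> A. (G *\<^sub>v (l @\<^sub>v u)) $ i = (G *\<^sub>v (l' @\<^sub>v u')) $ i) \<longrightarrow> l = l')"
    if "A \<in> \<AA>" for A
  proof -
    have A: "A \<subseteq> {..<n}" using sub that by blast
    have "ml_error (nss_space ?P) (secret_set ?P) (\<lambda>(L, U). L) (nss_shares ?P A) = 0 \<longleftrightarrow>
      (\<forall>\<omega>\<in>?T. \<forall>\<omega>'\<in>?T. nss_shares ?P A \<omega> = nss_shares ?P A \<omega>' \<longrightarrow> (\<lambda>(L, U). L) \<omega> = (\<lambda>(L, U). L) \<omega>')"
      by (rule ml_error_eq_0_iff[OF unif]) (auto simp: matrix_nss_def)
    also have "\<dots> \<longleftrightarrow> (\<forall>l\<in>carrier_vec x. \<forall>u\<in>carrier_vec y. \<forall>l'\<in>carrier_vec x. \<forall>u'\<in>carrier_vec y.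
        nss_shares ?P A (l, u) = nss_shares ?P A (l', u') \<longrightarrow> l = l')"
      by (simp only: split_paired_Ball_Sigma prod.case)
    finally show ?thesis using shares_eq[OF A] by simp
  qed
  show ?thesis
  proof
    assume cs: "csnss \<AA> \<BB> n ?P"
    show "sharing_matrix \<AA> \<BB> x y z G \<tau>"
      unfolding sharing_matrix_def
    proof (intro conjI ballI impI G)
      fix A l u assume A: "A \<in> \<AA>" and l: "l \<in> carrier_vec x" and u: "u \<in> carrier_vec y"
        and z: "\<forall>i\<in>positions z \<tau> A. (G *\<^sub>v (l @\<^sub>v u)) $ i = 0"
      have "(G *\<^sub>v (0\<^sub>v x @\<^sub>v 0\<^sub>v y)) $ i = 0" if "i \<in> positions z \<tau> A" for i
        using that G by (auto simp: zero_append_vec positions_def)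
      then have "\<forall>i\<in>positions z \<tau> A. (G *\<^sub>v (l @\<^sub>v u)) $ i = (G *\<^sub>v (0\<^sub>v x @\<^sub>v 0\<^sub>v y)) $ i"
        using z by simp
      moreover have "ml_error (nss_space ?P) (secret_set ?P) (\<lambda>(L, U). L) (nss_shares ?P A) = 0"
        using cs A unfolding csnss_def by blast
      ultimately show "l = 0\<^sub>v x"
        using l u unfolding dec[OF A] by (meson zero_carrier_vec)
    next
      fix B and l :: "'a Matrix.vec" assume B: "B \<in> \<BB>" and l: "l \<in> carrier_vec x"
      have "mutual_info (nss_space ?P) (\<lambda>(L, U). L) (nss_shares ?P B) = 0"
        using cs B unfolding csnss_def by blast
      \<comment> \<open>The secret \<open>l\<close> is combined with the shares \<open>B\<close>
        sees for the zero input; the seed of the resulting outcome is the required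
        \<open>u\<close>.\<close>
      moreover have "(l, 0\<^sub>v y) \<in> ?T" "(0\<^sub>v x, 0\<^sub>v y) \<in> ?T" using l by auto
      ultimately obtain \<omega> where \<omega>: "\<omega> \<in> ?T" "(\<lambda>(L, U). L) \<omega> = (\<lambda>(L, U). L) (l, 0\<^sub>v y :: 'a Matrix.vec)"
        "nss_shares ?P B \<omega> = nss_shares ?P B (0\<^sub>v x, 0\<^sub>v y)"
        by (rule mutual_info_eq_0_imp_support[OF unif])
      obtain u where u: "\<omega> = (l, u)" "u \<in> carrier_vec y" using \<omega>(1,2) by auto
      have "B \<subseteq> {..<n}" using sub B by blast
      then have "\<forall>i\<in>positions z \<tau> B. (G *\<^sub>v (l @\<^sub>v u)) $ i = (G *\<^sub>v (0\<^sub>v x @\<^sub>v 0\<^sub>v y)) $ i"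
        using \<omega>(3) l u by (simp add: shares_eq)
      moreover have "(G *\<^sub>v (0\<^sub>v x @\<^sub>v 0\<^sub>v y)) $ i = 0" if "i \<in> positions z \<tau> B" for i
        using that G by (auto simp: zero_append_vec positions_def)
      ultimately show "\<exists>u\<in>carrier_vec y. \<forall>i\<in>positions z \<tau> B. (G *\<^sub>v (l @\<^sub>v u)) $ i = 0"
        using u(2) by auto
    qed
  next
    assume sh: "sharing_matrix \<AA> \<BB> x y z G \<tau>"
    show "csnss \<AA> \<BB> n ?P"
      unfolding csnss_def
    proof (intro conjI ballI prot)
      fix A assume A: "A \<in> \<AA>"
      show "ml_error (nss_space ?P) (secret_set ?P) (\<lambda>(L, U). L) (nss_shares ?P A) = 0"
        unfolding dec[OF A] using sharing_matrix_recover[OF sh A] by blast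
    next
      fix B assume B: "B \<in> \<BB>"
      have Bn: "B \<subseteq> {..<n}" using sub B by blast
      show "mutual_info (nss_space ?P) (\<lambda>(L, U). L) (nss_shares ?P B) = 0"
      proof (rule mutual_info_eq_0I[OF unif])
        fix \<omega>1 \<omega>2 :: "'a Matrix.vec \<times> 'a Matrix.vec" assume "\<omega>1 \<in> ?T" "\<omega>2 \<in> ?T"
        then obtain l1 u1 l2 u2 where \<omega>: "\<omega>1 = (l1, u1)" "\<omega>2 = (l2, u2)"
          and l: "l1 \<in> carrier_vec x" "l2 \<in> carrier_vec x" by auto
        have "l2 - l1 \<in> carrier_vec x" using l by auto
        then obtain d where d: "d \<in> carrier_vec y"
          "\<And>i. i \<in> positions z \<tau> B \<Longrightarrow> (G *\<^sub>v ((l2 - l1) @\<^sub>v d)) $ i = 0"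
          using sh B unfolding sharing_matrix_def by blast
        \<comment> \<open>The shift \<open>d\<close> does not depend on the seed, so within one
          fibre the map is a translation and hence injective.\<close>
        define \<sigma> where "\<sigma> = (\<lambda>(l :: 'a Matrix.vec, u). (l2, u + d))"
        show "\<exists>\<sigma>. inj_on \<sigma> {\<omega> \<in> ?T. (case \<omega> of (L, U) \<Rightarrow> L) = (case \<omega>1 of (L, U) \<Rightarrow> L)} \<and>
          (\<forall>\<omega>\<in>?T. (case \<omega> of (L, U) \<Rightarrow> L) = (case \<omega>1 of (L, U) \<Rightarrow> L) \<longrightarrow>
            \<sigma> \<omega> \<in> ?T \<and> (case \<sigma> \<omega> of (L, U) \<Rightarrow> L) = (case \<omega>2 of (L, U) \<Rightarrow> L) \<and>
            nss_shares ?P B (\<sigma> \<omega>) = nss_shares ?P B \<omega>)"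
        proof (intro exI[of _ \<sigma>] conjI ballI impI)
          show "inj_on \<sigma> {\<omega> \<in> ?T. (case \<omega> of (L, U) \<Rightarrow> L) = (case \<omega>1 of (L, U) \<Rightarrow> L)}"
            using vec_add_right_cancel[OF _ _ d(1)] by (auto simp: \<sigma>_def \<omega> intro!: inj_onI)
          fix \<omega> assume "\<omega> \<in> ?T" "(case \<omega> of (L, U) \<Rightarrow> L) = (case \<omega>1 of (L, U) \<Rightarrow> L)"
          then obtain u where u: "\<omega> = (l1, u)" "u \<in> carrier_vec y" using \<omega> by auto
          show "\<sigma> \<omega> \<in> ?T" using u d l by (simp add: \<sigma>_def)
          show "(case \<sigma> \<omega> of (L, U) \<Rightarrow> L) = (case \<omega>2 of (L, U) \<Rightarrow> L)"
            by (simp add: u \<sigma>_def \<omega>)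
          have "(G *\<^sub>v (l2 @\<^sub>v (u + d))) $ i = (G *\<^sub>v (l1 @\<^sub>v u)) $ i" if "i \<in> positions z \<tau> B" for i
          proof -
            have "(l2 @\<^sub>v (u + d)) - (l1 @\<^sub>v u) = (l2 - l1) @\<^sub>v d"
              using u d l by (intro append_vec_add_diff)
            then have "G *\<^sub>v ((l2 - l1) @\<^sub>v d) = G *\<^sub>v (l2 @\<^sub>v (u + d)) - G *\<^sub>v (l1 @\<^sub>v u)"
              using u d l by (subst mult_minus_distrib_mat_vec[OF G, symmetric]) auto
            then show ?thesis using d(2)[OF that] that G by (simp add: positions_def)
          qed
          then show "nss_shares ?P B (\<sigma> \<omega>) = nss_shares ?P B \<omega>"
            using u d l by (simp add: \<sigma>_def shares_eq[OF Bn])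
        qed
      qed
    qed
  qed
qed

section \<open>Linear SPIR protocols\<close>

lemma dim_concat_files [simp]: "dim_vec (concat_files f x M) = f * x"
  by (simp add: concat_files_def)

lemma concat_files_carrier [simp]: "concat_files f x M \<in> carrier_vec (f * x)"
  by (rule carrier_vecI) simp

lemma block_unit_mat_carrier [simp]: "block_unit_mat f x k \<in> carrier_mat x (f * x)"
  by (simp add: block_unit_mat_def)

text \<open>Coordinate \<open>i\<close> of file \<open>k\<close> is stored at position
  \<open>k * x + i\<close> of the concatenation.\<close>

lemma block_index_less: "k < f \<Longrightarrow> i < x \<Longrightarrow> k * x + i < f * (x :: nat)"
  using mult_le_mono1[of "Suc k" f x] by simp

lemma block_unit_mat_mult_concat_files:
  fixes M :: "nat \<Rightarrow> 'a::comm_ring_1 Matrix.vec"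
  assumes k: "k < f" and M: "M k \<in> carrier_vec x"
  shows "block_unit_mat f x k *\<^sub>v concat_files f x M = M k"
proof (rule eq_vecI)
  fix i assume "i < dim_vec (M k)"
  then have i: "i < x" using M by simp
  have "(block_unit_mat f x k *\<^sub>v concat_files f x M) $ i
      = (\<Sum>j<f * x. if j = k * x + i then concat_files f x M $ j else 0)"
    using i by (simp add: block_unit_mat_def scalar_prod_def atLeast0LessThan mult_delta_left)
  also have "\<dots> = concat_files f x M $ (k * x + i)"
    using block_index_less[OF k i] by simp
  also have "\<dots> = M k $ i"
    using block_index_less[OF k i] i by (simp add: concat_files_def)
  finally show "(block_unit_mat f x k *\<^sub>v concat_files f x M) $ i = M k $ i" .
qed (use M in \<open>simp add: block_unit_mat_def\<close>)

section \<open>Answers and queries of linear protocols in terms of full vectors and rows\<close>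

context
  fixes n f x y z :: nat and \<tau> :: "nat \<Rightarrow> nat" and H :: "'a::{field,finite} mat"
    and Rs :: "'r set" and Q :: "nat \<Rightarrow> 'r \<Rightarrow> 'a mat"
  assumes f: "f > 0"
    and H: "H \<in> carrier_mat z y"
    and Q: "\<And>k r. k < f \<Longrightarrow> r \<in> Rs \<Longrightarrow> Q k r \<in> carrier_mat z (f * x)"
    and Rs: "finite Rs" "Rs \<noteq> {}"
begin

abbreviation "prot \<equiv> linear_spir_protocol n f x y z \<tau> H Rs Q"
abbreviation "files \<equiv> {..<f} \<rightarrow>\<^sub>E (carrier_vec x :: 'a Matrix.vec set)"
abbreviation "seeds \<equiv> carrier_vec y :: 'a Matrix.vec set"
abbreviation "reply k r M U \<equiv> Q k r *\<^sub>v concat_files f x M + H *\<^sub>v U"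
abbreviation "outcomes \<equiv> files \<times> seeds \<times> {..<f} \<times> Rs"
abbreviation "cond_outcomes k r \<equiv> files \<times> seeds \<times> {k} \<times> {r}"

lemma reply_carrier: "k < f \<Longrightarrow> r \<in> Rs \<Longrightarrow> U \<in> seeds \<Longrightarrow> reply k r M U \<in> carrier_vec z"
  using H Q[of k r] by (intro add_carrier_vec mult_mat_vec_carrier[of _ _ "f * x"] mult_mat_vec_carrier[of _ _ y]) auto

lemma finite_outcomes: "finite outcomes"
  using Rs by (intro finite_cartesian_product finite_PiE finite_carrier_vec) auto

lemma uniform_on_spir_space: "uniform_on (spir_space f prot) outcomes"
proof -
  obtain r where r: "r \<in> Rs" using Rs by auto
  have "((\<lambda>j\<in>{..<f}. 0\<^sub>v x), 0\<^sub>v y, 0, r) \<in> outcomes" using r f by auto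
  moreover have "spir_space f prot = uniform_count_measure outcomes"
    by (simp add: spir_space_def linear_spir_protocol_def)
  ultimately show ?thesis
    using uniform_on_uniform_count_measure[OF finite_outcomes] by (metis empty_iff)
qed

lemma uniform_on_spir_cond_space:
  assumes "k < f" "r \<in> Rs"
  shows "uniform_on (spir_cond_space f prot k r) (cond_outcomes k r)"
proof -
  have S: "spir_space f prot = uniform_count_measure outcomes"
    by (simp add: spir_space_def linear_spir_protocol_def)
  have "{(M, U, K, R) \<in> space (spir_space f prot). K = k \<and> R = r} = cond_outcomes k r"
    unfolding S space_uniform_count_measure using assms by auto
  then have "spir_cond_space f prot k r = uniform_measure (uniform_count_measure outcomes) (cond_outcomes k r)"
    unfolding spir_cond_space_def S by simp
  moreover have "((\<lambda>j\<in>{..<f}. 0\<^sub>v x), 0\<^sub>v y, k, r) \<in> cond_outcomes k r" by auto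
  moreover have "cond_outcomes k r \<subseteq> outcomes" using assms by auto
  ultimately show ?thesis
    using uniform_on_uniform_measure[OF finite_outcomes, of "cond_outcomes k r"] by (metis empty_iff)
qed

text \<open>Selecting rows commutes with multiplication and addition, so all answers are blocks of
  the single vector \<open>reply\<close>, just as shares are blocks of one vector.\<close>

lemma spir_answers_eq:
  assumes "X \<subseteq> {..<n}" "k < f" "r \<in> Rs" "U \<in> seeds"
  shows "spir_answers prot X (M, U, k, r) = (\<lambda>j\<in>X. subvec (reply k r M U) (positions z \<tau> {j}))"
proof -
  have "subrows (Q k r) I *\<^sub>v concat_files f x M + subrows H I *\<^sub>v U = subvec (reply k r M U) I" for I
    unfolding subrows_mult_vec using Q[of k r] H assms by (intro subvec_add) simp
  then show ?thesis
    using assms(1) by (auto simp: spir_answers_def linear_spir_protocol_def intro!: restrict_ext)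
qed

lemma spir_answers_eq_iff:
  assumes "X \<subseteq> {..<n}" "k < f" "r \<in> Rs" "U \<in> seeds" "U' \<in> seeds"
  shows "spir_answers prot X (M, U, k, r) = spir_answers prot X (M', U', k, r) \<longleftrightarrow>
    (\<forall>i\<in>positions z \<tau> X. reply k r M U $ i = reply k r M' U' $ i)"
  using assms by (simp only: spir_answers_eq restrict_subvec_positions_eq_iff reply_carrier)

lemma spir_queries_eq_iff:
  assumes "X \<subseteq> {..<n}" "k < f" "r \<in> Rs" "k' < f" "r' \<in> Rs"
  shows "spir_queries prot X (M, U, k, r) = spir_queries prot X (M', U', k', r') \<longleftrightarrow>
    (\<forall>i\<in>positions z \<tau> X. row (Q k r) i = row (Q k' r') i)"
proof -
  have "spir_queries prot X (M, U, k, r) = (\<lambda>j\<in>X. subrows (Q k r) (positions z \<tau> {j}))" for M U k r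
    using assms(1) by (auto simp: spir_queries_def linear_spir_protocol_def intro!: restrict_ext)
  then show ?thesis
    using restrict_subrows_positions_eq_iff[OF Q Q] assms by simp
qed

lemma spir_protocol_linear: "spir_protocol n f prot"
  unfolding spir_protocol_def
proof (intro conjI allI ballI impI)
  fix j q m t
  assume "q \<in> query_set prot j" "t \<in> rand_share_set prot j"
  then show "answer_map prot j q m t \<in> answer_set prot j"
    by (auto simp: linear_spir_protocol_def)
next
  fix u assume "u \<in> seed_set prot"
  then have "H *\<^sub>v u \<in> carrier_vec z" using H by (auto simp: linear_spir_protocol_def)
  then show "rand_share_map prot u \<in> (\<Pi>\<^sub>E j\<in>{..<n}. rand_share_set prot j)"
    by (auto simp: linear_spir_protocol_def subrows_mult_vec intro!: subvec_positions_carrier)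
next
  fix k r assume "k < f" "r \<in> user_rand_set prot"
  then have "Q k r \<in> carrier_mat z (f * x)" using Q by (auto simp: linear_spir_protocol_def)
  then show "query_map prot k r \<in> (\<Pi>\<^sub>E j\<in>{..<n}. query_set prot j)"
    by (auto simp: linear_spir_protocol_def intro!: subrows_positions_carrier)
qed (use Rs in \<open>auto simp: linear_spir_protocol_def finite_carrier_vec finite_carrier_mat carrier_vec_nonempty\<close>)

lemma spir_correct_iff:
  assumes "\<And>A. A \<in> \<AA> \<Longrightarrow> A \<subseteq> {..<n}"
  shows "spir_correct \<AA> f prot \<longleftrightarrow>
    (\<forall>r\<in>Rs. \<forall>k<f. \<forall>A\<in>\<AA>. \<forall>M\<in>files. \<forall>U\<in>seeds. \<forall>M'\<in>files. \<forall>U'\<in>seeds.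
      (\<forall>i\<in>positions z \<tau> A. reply k r M U $ i = reply k r M' U' $ i) \<longrightarrow> M k = M' k)"
proof -
  have "ml_error (spir_cond_space f prot k r) (file_set prot) (\<lambda>(M, U, K, R). M k) (spir_answers prot A) = 0 \<longleftrightarrow>
    (\<forall>M\<in>files. \<forall>U\<in>seeds. \<forall>M'\<in>files. \<forall>U'\<in>seeds.
      (\<forall>i\<in>positions z \<tau> A. reply k r M U $ i = reply k r M' U' $ i) \<longrightarrow> M k = M' k)"
    if r: "r \<in> Rs" and k: "k < f" and A: "A \<in> \<AA>" for r k A
  proof -
    have "ml_error (spir_cond_space f prot k r) (file_set prot) (\<lambda>(M, U, K, R). M k) (spir_answers prot A) = 0 \<longleftrightarrow>
      (\<forall>\<omega>\<in>cond_outcomes k r. \<forall>\<omega>'\<in>cond_outcomes k r. spir_answers prot A \<omega> = spir_answers prot A \<omega>' \<longrightarrow>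
        (\<lambda>(M, U, K, R). M k) \<omega> = (\<lambda>(M, U, K, R). M k) \<omega>')"
      by (rule ml_error_eq_0_iff[OF uniform_on_spir_cond_space[OF k r]])
        (use k in \<open>auto simp: linear_spir_protocol_def\<close>)
    also have "\<dots> \<longleftrightarrow> (\<forall>M\<in>files. \<forall>U\<in>seeds. \<forall>M'\<in>files. \<forall>U'\<in>seeds.
        spir_answers prot A (M, U, k, r) = spir_answers prot A (M', U', k, r) \<longrightarrow> M k = M' k)"
      by (simp only: split_paired_Ball_Sigma prod.case ball_simps(5,7) simp_thms)
    finally show ?thesis
      using spir_answers_eq_iff[OF assms[OF A] k r] by simp
  qed
  then show ?thesis
    unfolding spir_correct_def by (simp add: linear_spir_protocol_def)
qed

text \<open>Independence combines the answers to \<open>M\<close> with the unwanted files of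
  \<open>M'\<close>; the \<open>k\<close>-th file of the new tuple is left open. Since all servers
  together hold every position, equality of answers is equality of whole replies.\<close>

lemma spir_server_secret_shift:
  assumes sec: "spir_server_secret n f prot" and \<tau>: "\<tau> \<in> {..<z} \<rightarrow> {..<n}"
    and k: "k < f" and r: "r \<in> Rs" and M: "M \<in> files" "M' \<in> files" and U: "U \<in> seeds"
  obtains M'' U'' where "M'' \<in> files" "U'' \<in> seeds"
    "\<And>j. j < f \<Longrightarrow> j \<noteq> k \<Longrightarrow> M'' j = M' j" "reply k r M'' U'' = reply k r M U"
proof -
  let ?rest = "\<lambda>(M, U, K, R). restrict M ({..<f} - {k})"
  have all: "positions z \<tau> {..<n} = {..<z}" using \<tau> by (auto simp: positions_def Pi_def)
  have "mutual_info (spir_cond_space f prot k r) (spir_answers prot {..<n}) ?rest = 0"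
    using sec k r unfolding spir_server_secret_def by (auto simp: linear_spir_protocol_def)
  moreover have "(M, U, k, r) \<in> cond_outcomes k r" "(M', U, k, r) \<in> cond_outcomes k r" using M U by auto
  ultimately obtain \<omega> where \<omega>: "\<omega> \<in> cond_outcomes k r"
    "spir_answers prot {..<n} \<omega> = spir_answers prot {..<n} (M, U, k, r)"
    "?rest \<omega> = ?rest (M', U, k, r)"
    by (rule mutual_info_eq_0_imp_support[OF uniform_on_spir_cond_space[OF k r]])
  obtain M'' U'' where o: "\<omega> = (M'', U'', k, r)" "M'' \<in> files" "U'' \<in> seeds"
    using \<omega>(1) by (cases \<omega>) auto
  have "\<forall>i\<in>{..<z}. reply k r M'' U'' $ i = reply k r M U $ i"
    using \<omega>(2) o k r U by (simp add: spir_answers_eq_iff all)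
  moreover have "reply k r M'' U'' \<in> carrier_vec z" "reply k r M U \<in> carrier_vec z"
    using reply_carrier k r U o by blast+
  moreover have "v = w"
    if "\<forall>i\<in>{..<z}. v $ i = w $ i" "v \<in> carrier_vec z" "w \<in> carrier_vec z" for v w :: "'a Matrix.vec"
    using that by (intro eq_vecI) auto
  ultimately have "reply k r M'' U'' = reply k r M U" by blast
  moreover have "M'' j = M' j" if "j < f" "j \<noteq> k" for j
    using fun_cong[OF \<omega>(3), of j] that by (simp add: o)
  ultimately show ?thesis using o that by blast
qed

lemma spir_user_secret_switch:
  assumes sec: "spir_user_secret \<BB> f prot" and B: "B \<in> \<BB>" "B \<subseteq> {..<n}"
    and k: "k < f" "k' < f" and r: "r \<in> Rs"
  obtains r' where "r' \<in> Rs" "\<And>i. i \<in> positions z \<tau> B \<Longrightarrow> row (Q k' r') i = row (Q k r) i"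
proof -
  let ?K = "\<lambda>(M, U, K, R). K" and ?M = "\<lambda>j\<in>{..<f}. 0\<^sub>v x :: 'a Matrix.vec"
  have "mutual_info (spir_space f prot) ?K (spir_queries prot B) = 0"
    using sec B unfolding spir_user_secret_def by blast
  \<comment> \<open>Queries depend only on \<open>K\<close> and \<open>R\<close>; the zero files and
    zero seed merely complete the outcomes.\<close>
  moreover have "(?M, 0\<^sub>v y, k', r) \<in> outcomes" "(?M, 0\<^sub>v y, k, r) \<in> outcomes" using k r by auto
  ultimately obtain \<omega> where \<omega>: "\<omega> \<in> outcomes" "?K \<omega> = ?K (?M, 0\<^sub>v y :: 'a Matrix.vec, k', r)"
    "spir_queries prot B \<omega> = spir_queries prot B (?M, 0\<^sub>v y, k, r)"
    by (rule mutual_info_eq_0_imp_support[OF uniform_on_spir_space])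
  obtain M U r' where o: "\<omega> = (M, U, k', r')" "r' \<in> Rs" using \<omega>(1,2) by (cases \<omega>) auto
  have "\<forall>i\<in>positions z \<tau> B. row (Q k' r') i = row (Q k r) i"
    using \<omega>(3) o k r by (simp add: spir_queries_eq_iff[OF B(2)])
  with o that show ?thesis by blast
qed

end

lemma spir_rates:
  fixes H :: "'a::{field,finite} mat"
  assumes "\<tau> \<in> {..<z} \<rightarrow> {..<n}"
  shows "pir_rate n (linear_spir_protocol n f x y z \<tau> H Rs Q) = x / z"
    and "shared_randomness_rate (linear_spir_protocol n f x y z \<tau> H Rs Q) = y / x"
proof -
  have ne: "log 2 CARD('a) \<noteq> 0" using log_card_field_pos[where 'a = 'a] by linarith
  show "pir_rate n (linear_spir_protocol n f x y z \<tau> H Rs Q) = x / z"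
    unfolding pir_rate_def linear_spir_protocol_def spir.select_convs sum_log_card_positions[OF assms]
    unfolding log_card_carrier_vec by (rule mult_divide_mult_cancel_right[OF ne])
  show "shared_randomness_rate (linear_spir_protocol n f x y z \<tau> H Rs Q) = y / x"
    unfolding shared_randomness_rate_def linear_spir_protocol_def spir.select_convs
      log_card_carrier_vec by (rule mult_divide_mult_cancel_right[OF ne])
qed

text \<open>The matrix puts the columns of file 0 in one fixed query \<open>Q 0 r0\<close> next to
  \<open>H\<close>. Applied to \<open>l\<close> and \<open>u\<close>, it returns the reply to the
  tuple with \<open>l\<close> as file 0 and zeros elsewhere, so properties of replies become
  properties of its kernel.\<close>

lemma csspir_imp_sharing_matrix:
  fixes H :: "'a::{field,finite} mat"
  assumes acc: "access_structure n \<AA> \<BB>" "\<AA> \<noteq> {}" and \<tau>: "\<tau> \<in> {..<z} \<rightarrow> {..<n}"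
    and x: "x \<ge> 1" and f: "f \<ge> 2"
    and H: "H \<in> carrier_mat z y" and Q: "\<forall>k<f. \<forall>r\<in>Rs. Q k r \<in> carrier_mat z (f * x)"
    and P: "csspir \<AA> \<BB> n f (linear_spir_protocol n f x y z \<tau> H Rs Q)"
  shows "\<exists>G :: 'a mat. sharing_matrix \<AA> \<BB> x y z G \<tau>"
proof -
  let ?P = "linear_spir_protocol n f x y z \<tau> H Rs Q"
  let ?files = "{..<f} \<rightarrow>\<^sub>E (carrier_vec x :: 'a Matrix.vec set)"
  let ?reply = "\<lambda>k r M U. Q k r *\<^sub>v concat_files f x M + H *\<^sub>v U"
  have Rs: "finite Rs" "Rs \<noteq> {}"
    using P unfolding csspir_def spir_protocol_def by (simp_all add: linear_spir_protocol_def)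
  have f0: "f > 0" using f by simp
  have Q': "Q k r \<in> carrier_mat z (f * x)" if "k < f" "r \<in> Rs" for k r using Q that by blast
  have sub: "A \<subseteq> {..<n}" if "A \<in> \<AA> \<union> \<BB>" for A
    using acc that by (auto simp: access_structure_def)
  \<comment> \<open>Some authorised set exists, and every larger set of servers is
    authorised.\<close>
  have full: "{..<n} \<in> \<AA>"
    using acc by (auto simp: access_structure_def)
  have all: "positions z \<tau> {..<n} = {..<z}" using \<tau> by (auto simp: positions_def Pi_def)
  have correct: "M k = M' k"
    if "r \<in> Rs" "k < f" "A \<in> \<AA>" "M \<in> ?files" "U \<in> carrier_vec y" "M' \<in> ?files" "U' \<in> carrier_vec y"
      "\<forall>i\<in>positions z \<tau> A. ?reply k r M U $ i = ?reply k r M' U' $ i" for r k A M U M' U'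
  proof -
    have "spir_correct \<AA> f ?P" using P by (simp add: csspir_def)
    then show ?thesis
      using spir_correct_iff[of f H z y Rs Q x \<AA> n \<tau>, OF f0 H Q' Rs] sub that by blast
  qed
  define M0 where "M0 = (\<lambda>j\<in>{..<f}. 0\<^sub>v x :: 'a Matrix.vec)"
  have M0: "M0 \<in> ?files" by (auto simp: M0_def)
  have reply0: "?reply k r M0 (0\<^sub>v y) $ i = 0" if "k < f" "r \<in> Rs" "i < z" for k r i
  proof -
    have "concat_files f x M0 = 0\<^sub>v (f * x)"
      using x by (intro eq_vecI) (auto simp: concat_files_def M0_def less_mult_imp_div_less)
    then show ?thesis using Q'[OF that(1,2)] H that(3) by simp
  qed
  define first where "first l = (\<lambda>j\<in>{..<f}. if j = 0 then l else 0\<^sub>v x)" for l :: "'a Matrix.vec"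
  have first: "first l \<in> ?files" if "l \<in> carrier_vec x" for l using that by (auto simp: first_def)

  text \<open>Server secrecy provides a reply to \<open>0\<close> whose other files agree with \<open>M\<close>; by correctness
    for the full server set its \<open>k\<close>-th file is \<open>0\<close>. So \<open>M\<close> with \<open>M k = 0\<close> is masked by \<open>H\<close>.\<close>
  have mask: "\<exists>U\<in>carrier_vec y. \<forall>i<z. ?reply k r M U $ i = 0"
    if k: "k < f" and r: "r \<in> Rs" and M: "M \<in> ?files" "M k = 0\<^sub>v x" for k r M
  proof -
    have sec: "spir_server_secret n f ?P" using P by (simp add: csspir_def)
    obtain M' U' where M': "M' \<in> ?files" "U' \<in> carrier_vec y"
      "\<And>j. j < f \<Longrightarrow> j \<noteq> k \<Longrightarrow> M' j = M j" "?reply k r M' U' = ?reply k r M0 (0\<^sub>v y)"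
      using spir_server_secret_shift[of f H z y Rs Q x n \<tau> k r M0 M "0\<^sub>v y", OF f0 H Q' Rs sec \<tau> k r M0 M(1)]
      by auto
    have "M' k = M0 k"
      using correct[OF r k full M'(1,2) M0, of "0\<^sub>v y"] M'(4) by simp
    then have "M' j = M j" if "j < f" for j
      using M'(3)[OF that] M(2) k by (cases "j = k") (auto simp: M0_def)
    then have "M' = M" using M'(1) M(1) by (intro PiE_ext) auto
    then have "?reply k r M U' = ?reply k r M0 (0\<^sub>v y)" using M'(4) by (simp only:)
    then have "\<forall>i<z. ?reply k r M U' $ i = 0" using reply0[OF k r] by (simp only:) blast
    then show ?thesis using M'(2) by blast
  qed
  obtain r0 where r0: "r0 \<in> Rs" using Rs by auto
  define G where "G = Matrix.mat z (x + y) (\<lambda>(i, j). if j < x then Q 0 r0 $$ (i, j) else H $$ (i, j - x))"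
  have G: "G \<in> carrier_mat z (x + y)" by (simp add: G_def)
  have G_reply: "(G *\<^sub>v (l @\<^sub>v u)) $ i = ?reply 0 r0 (first l) u $ i"
    if l: "l \<in> carrier_vec x" and u: "u \<in> carrier_vec y" and i: "i < z" for l u i
  proof -
    have "(Q 0 r0 *\<^sub>v concat_files f x (first l)) $ i
        = (\<Sum>j<f * x. Q 0 r0 $$ (i, j) * concat_files f x (first l) $ j)"
      using Q'[OF f0 r0] i by (simp add: scalar_prod_def atLeast0LessThan)
    \<comment> \<open>Positions from \<open>x\<close> onwards belong to other files, which are zero
      in \<open>first l\<close>.\<close>
    also have "\<dots> = (\<Sum>j<x. Q 0 r0 $$ (i, j) * concat_files f x (first l) $ j)"
      using f0 by (intro sum.mono_neutral_right)
        (auto simp: concat_files_def first_def less_mult_imp_div_less div_eq_0_iff)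
    also have "\<dots> = (\<Sum>j<x. Q 0 r0 $$ (i, j) * l $ j)"
    proof (intro sum.cong refl)
      fix j assume "j \<in> {..<x}"
      then have "j < x" "j < f * x" using f0 by (auto intro: less_le_trans[of j x "f * x"])
      then show "Q 0 r0 $$ (i, j) * concat_files f x (first l) $ j = Q 0 r0 $$ (i, j) * l $ j"
        using f0 by (simp add: concat_files_def first_def)
    qed
    finally have "?reply 0 r0 (first l) u $ i
        = (\<Sum>j<x. Q 0 r0 $$ (i, j) * l $ j) + (\<Sum>j<y. H $$ (i, j) * u $ j)"
      using H u i by (simp add: scalar_prod_def atLeast0LessThan)
    then show ?thesis
      using i by (simp add: index_mult_append_vec[OF G l u i]) (simp add: G_def)
  qed
  have "sharing_matrix \<AA> \<BB> x y z G \<tau>"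
    unfolding sharing_matrix_def
  proof (intro conjI ballI impI G)
    fix A and l u :: "'a Matrix.vec"
    assume A: "A \<in> \<AA>" and l: "l \<in> carrier_vec x" and u: "u \<in> carrier_vec y"
      and zero: "\<forall>i\<in>positions z \<tau> A. (G *\<^sub>v (l @\<^sub>v u)) $ i = 0"
    have "\<forall>i\<in>positions z \<tau> A. ?reply 0 r0 (first l) u $ i = ?reply 0 r0 M0 (0\<^sub>v y) $ i"
    proof
      fix i assume i: "i \<in> positions z \<tau> A"
      then have iz: "i < z" by (simp add: positions_def)
      have "?reply 0 r0 (first l) u $ i = (G *\<^sub>v (l @\<^sub>v u)) $ i"
        by (rule G_reply[OF l u iz, symmetric])
      also have "\<dots> = 0" using zero i by blast
      also have "\<dots> = ?reply 0 r0 M0 (0\<^sub>v y) $ i" by (rule reply0[OF f0 r0 iz, symmetric])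
      finally show "?reply 0 r0 (first l) u $ i = ?reply 0 r0 M0 (0\<^sub>v y) $ i" .
    qed
    then have "first l 0 = M0 0"
      by (intro correct[OF r0 f0 A first[OF l] u M0 zero_carrier_vec])
    then show "l = 0\<^sub>v x" using f0 by (simp add: first_def M0_def)
  next
    fix B and l :: "'a Matrix.vec" assume B: "B \<in> \<BB>" and l: "l \<in> carrier_vec x"
    have "spir_user_secret \<BB> f ?P" using P by (simp add: csspir_def)
    moreover have f1: "1 < f" using f by simp
    moreover have "B \<subseteq> {..<n}" using sub B by blast
    ultimately obtain r where r: "r \<in> Rs"
      and row: "\<And>i. i \<in> positions z \<tau> B \<Longrightarrow> row (Q 1 r) i = row (Q 0 r0) i"
      using spir_user_secret_switch[of f H z y Rs Q x \<BB> n \<tau> B 0 1 r0, OF f0 H Q' Rs] B f0 r0 by metis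
    \<comment> \<open>In a query for file 1 the tuple \<open>first l\<close> has wanted file zero,
      so some seed masks its reply completely.\<close>
    have "first l 1 = 0\<^sub>v x" using f1 by (simp add: first_def)
    then obtain u where u: "u \<in> carrier_vec y" "\<And>i. i < z \<Longrightarrow> ?reply 1 r (first l) u $ i = 0"
      using mask[OF f1 r first[OF l]] by blast
    have "(G *\<^sub>v (l @\<^sub>v u)) $ i = 0" if i: "i \<in> positions z \<tau> B" for i
    proof -
      have iz: "i < z" using i by (simp add: positions_def)
      \<comment> \<open>The two queries agree on the rows of \<open>B\<close>, so the seed found for
        file 1 also cancels the reply to the query for file 0 there.\<close>
      have "?reply 0 r0 (first l) u $ i = ?reply 1 r (first l) u $ i"
        using row[OF i] Q'[OF f0 r0] Q'[OF f1 r] H iz by simp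
      then show ?thesis using u(2)[OF iz] G_reply[OF l u(1) iz] by simp
    qed
    then show "\<exists>u\<in>carrier_vec y. \<forall>i\<in>positions z \<tau> B. (G *\<^sub>v (l @\<^sub>v u)) $ i = 0"
      using u(1) by blast
  qed
  then show ?thesis by blast
qed

section \<open>The projected protocol built from a sharing matrix\<close>

lemma vec_masked_cancel:
  fixes a b u u' :: "'a::ab_group_add Matrix.vec"
  assumes carr: "a \<in> carrier_vec y" "b \<in> carrier_vec y" "u \<in> carrier_vec y" "u' \<in> carrier_vec y"
    and eq: "(a + u) - b = (a + u') - b"
  shows "u = u'"
proof (rule eq_vecI)
  fix i assume "i < dim_vec u'"
  then have i: "i < y" using carr by simp
  have "((a + u) - b) $ i = ((a + u') - b) $ i" using eq by simp
  then show "u $ i = u' $ i" using i carr by simp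
qed (use carr in simp)

lemma vec_add_diff_cancel:
  fixes a b :: "'a::ab_group_add Matrix.vec"
  assumes "b \<in> carrier_vec y" "a \<in> carrier_vec y"
  shows "b + (a - b) = a"
  using assms by (intro eq_vecI) simp_all

text \<open>The labels in \<open>Rs\<close> stand for uniform matrices through the bijection
  \<open>dec\<close>. Natural-number labels serve (a), and the matrices themselves, with
  \<open>dec\<close> the identity, serve (d).\<close>

lemma sharing_matrix_imp_csspir:
  fixes G :: "'a::{field,finite} mat" and dec :: "'r \<Rightarrow> 'a mat"
  assumes acc: "access_structure n \<AA> \<BB>" and f: "f > 0"
    and G: "sharing_matrix \<AA> \<BB> x y z G \<tau>"
    and dec: "bij_betw dec Rs (carrier_mat y (f * x))"
  defines "J \<equiv> Matrix.mat z x (\<lambda>(i, j). G $$ (i, j))"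
    and "H \<equiv> Matrix.mat z y (\<lambda>(i, j). G $$ (i, x + j))"
  shows "csspir \<AA> \<BB> n f (linear_spir_protocol n f x y z \<tau> H Rs (\<lambda>k r. J * block_unit_mat f x k + H * dec r))"
proof -
  let ?Q = "\<lambda>k r. J * block_unit_mat f x k + H * dec r"
  let ?P = "linear_spir_protocol n f x y z \<tau> H Rs ?Q"
  let ?files = "{..<f} \<rightarrow>\<^sub>E (carrier_vec x :: 'a Matrix.vec set)"
  let ?c = "concat_files f x :: (nat \<Rightarrow> 'a Matrix.vec) \<Rightarrow> 'a Matrix.vec"
  let ?reply = "\<lambda>k r M U. ?Q k r *\<^sub>v ?c M + H *\<^sub>v U"
  have Gc: "G \<in> carrier_mat z (x + y)" using G by (simp add: sharing_matrix_def)
  have J: "J \<in> carrier_mat z x" and H: "H \<in> carrier_mat z y" by (simp_all add: J_def H_def)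
  have deccarr: "dec r \<in> carrier_mat y (f * x)" if "r \<in> Rs" for r
    using dec that by (auto simp: bij_betw_def)
  have Q: "?Q k r \<in> carrier_mat z (f * x)" if "k < f" "r \<in> Rs" for k r
    using J H deccarr[OF that(2)] by (intro add_carrier_mat mult_carrier_mat) auto
  have Rs: "finite Rs" "Rs \<noteq> {}"
  proof -
    show "finite Rs" using dec finite_carrier_mat bij_betw_finite by blast
    have "0\<^sub>m y (f * x) \<in> dec ` Rs" using dec by (simp add: bij_betw_def)
    then show "Rs \<noteq> {}" by auto
  qed
  have sub: "A \<subseteq> {..<n}" if "A \<in> \<AA> \<union> \<BB>" for A
    using acc that by (auto simp: access_structure_def)
  have JH: "J *\<^sub>v l + H *\<^sub>v u = G *\<^sub>v (l @\<^sub>v u)" if "l \<in> carrier_vec x" "u \<in> carrier_vec y" for l u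
  proof (rule eq_vecI)
    fix i assume "i < dim_vec (G *\<^sub>v (l @\<^sub>v u))"
    then have i: "i < z" using Gc by simp
    then show "(J *\<^sub>v l + H *\<^sub>v u) $ i = (G *\<^sub>v (l @\<^sub>v u)) $ i"
      using that by (simp add: index_mult_append_vec[OF Gc that i])
        (simp add: J_def H_def scalar_prod_def atLeast0LessThan)
  qed (use Gc H in simp)

  text \<open>Given \<open>R\<close>, the replies are the shares of the \<open>k\<close>-th file with seed \<open>R M + U\<close>.\<close>
  have reply: "?reply k r M U = G *\<^sub>v (M k @\<^sub>v (dec r *\<^sub>v ?c M + U))"
    if k: "k < f" and r: "r \<in> Rs" and M: "M \<in> ?files" and U: "U \<in> carrier_vec y" for k r M U
  proof -
    have Mk: "M k \<in> carrier_vec x" using M k by auto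
    have dM: "dec r *\<^sub>v ?c M \<in> carrier_vec y" using deccarr[OF r] by simp
    have "?Q k r *\<^sub>v ?c M = (J * block_unit_mat f x k) *\<^sub>v ?c M + (H * dec r) *\<^sub>v ?c M"
      using J H deccarr[OF r]
      by (intro add_mult_distrib_mat_vec[of _ z "f * x"] mult_carrier_mat[of _ z]) auto
    also have "(J * block_unit_mat f x k) *\<^sub>v ?c M = J *\<^sub>v M k"
      using J block_unit_mat_mult_concat_files[of k f M x, OF k Mk]
      by (subst assoc_mult_mat_vec[of _ z x _ "f * x"]) auto
    also have "(H * dec r) *\<^sub>v ?c M = H *\<^sub>v (dec r *\<^sub>v ?c M)"
      using H deccarr[OF r] by (intro assoc_mult_mat_vec[of _ z y _ "f * x"]) auto
    finally have "?reply k r M U = J *\<^sub>v M k + (H *\<^sub>v (dec r *\<^sub>v ?c M) + H *\<^sub>v U)"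
      using J H Mk dM U by (simp add: assoc_add_vec[of _ z])
    also have "\<dots> = J *\<^sub>v M k + H *\<^sub>v (dec r *\<^sub>v ?c M + U)"
      by (simp add: mult_add_distrib_mat_vec[OF H dM U])
    finally show ?thesis using JH[OF Mk, of "dec r *\<^sub>v ?c M + U"] dM U by simp
  qed

  have "spir_protocol n f ?P"
    using spir_protocol_linear[of f H z y Rs ?Q x n \<tau>, OF f H Q Rs] .
  moreover have "spir_correct \<AA> f ?P"
  proof (subst spir_correct_iff[of f H z y Rs ?Q x \<AA> n \<tau>, OF f H Q Rs])
    show "A \<subseteq> {..<n}" if "A \<in> \<AA>" for A using sub that by blast
    show "\<forall>r\<in>Rs. \<forall>k<f. \<forall>A\<in>\<AA>. \<forall>M\<in>?files. \<forall>U\<in>carrier_vec y. \<forall>M'\<in>?files. \<forall>U'\<in>carrier_vec y.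
      (\<forall>i\<in>positions z \<tau> A. ?reply k r M U $ i = ?reply k r M' U' $ i) \<longrightarrow> M k = M' k"
    proof (intro ballI allI impI)
      fix r k A M U M' U'
      assume r: "r \<in> Rs" and k: "k < f" and A: "A \<in> \<AA>" and M: "M \<in> ?files" and U: "U \<in> carrier_vec y"
        and M': "M' \<in> ?files" and U': "U' \<in> carrier_vec y"
        and eq: "\<forall>i\<in>positions z \<tau> A. ?reply k r M U $ i = ?reply k r M' U' $ i"
      show "M k = M' k"
      proof (rule sharing_matrix_recover[OF G A])
        show "\<forall>i\<in>positions z \<tau> A. (G *\<^sub>v (M k @\<^sub>v (dec r *\<^sub>v ?c M + U))) $ i
            = (G *\<^sub>v (M' k @\<^sub>v (dec r *\<^sub>v ?c M' + U'))) $ i"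
          using eq unfolding reply[OF k r M U] reply[OF k r M' U'] .
      qed (use M M' U U' k deccarr[OF r] in auto)
    qed
  qed
  moreover have "spir_server_secret n f ?P"
    unfolding spir_server_secret_def
  proof (intro ballI allI impI)
    fix r k assume "r \<in> user_rand_set ?P" and k: "k < f"
    then have r: "r \<in> Rs" by (simp add: linear_spir_protocol_def)
    let ?T = "?files \<times> (carrier_vec y :: 'a Matrix.vec set) \<times> {k} \<times> {r}"
    let ?X = "\<lambda>(M, U, K, R). restrict M ({..<f} - {k})"
    have unif: "uniform_on (spir_cond_space f ?P k r) ?T"
      by (rule uniform_on_spir_cond_space[of f H z y Rs ?Q x k r n \<tau>, OF f H Q Rs k r])
    have "mutual_info (spir_cond_space f ?P k r) ?X (spir_answers ?P {..<n}) = 0"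
    proof (rule mutual_info_eq_0I[OF unif])
      fix \<omega>1 \<omega>2 assume "\<omega>1 \<in> ?T" "\<omega>2 \<in> ?T"
      then obtain M1 U1 M2 U2 where \<omega>: "\<omega>1 = (M1, U1, k, r)" "\<omega>2 = (M2, U2, k, r)"
        and M: "M1 \<in> ?files" "M2 \<in> ?files" by auto
      \<comment> \<open>Takes the unwanted files from the target tuple \<open>M2\<close> and keeps
        the wanted one.\<close>
      define swap where "swap M = M2(k := M k)" for M :: "nat \<Rightarrow> 'a Matrix.vec"
      \<comment> \<open>The seed is adjusted so that \<open>dec r\<close> times the files, plus the
        seed, is preserved. As the reply depends only on this sum and on file \<open>k\<close>, it
        does not change.\<close>
      define \<sigma> where "\<sigma> = (\<lambda>(M, U, K :: nat, R :: 'r).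
        (swap M, (dec r *\<^sub>v ?c M + U) - dec r *\<^sub>v ?c (swap M), K, R))"
      have swap: "swap M \<in> ?files" if "M \<in> ?files" for M
        using M(2) that k by (auto simp: swap_def PiE_def extensional_def)
      have dv: "dec r *\<^sub>v ?c M \<in> carrier_vec y" for M using deccarr[OF r] by simp
      show "\<exists>\<sigma>. inj_on \<sigma> {\<omega> \<in> ?T. ?X \<omega> = ?X \<omega>1} \<and>
        (\<forall>\<omega>\<in>?T. ?X \<omega> = ?X \<omega>1 \<longrightarrow> \<sigma> \<omega> \<in> ?T \<and> ?X (\<sigma> \<omega>) = ?X \<omega>2 \<and>
          spir_answers ?P {..<n} (\<sigma> \<omega>) = spir_answers ?P {..<n} \<omega>)"
      proof (intro exI[of _ \<sigma>] conjI ballI impI)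
        \<comment> \<open>The fibre fixes the unwanted files and \<open>swap\<close> retains file
          \<open>k\<close>, which determines \<open>M\<close>; the seed then follows by
          cancellation.\<close>
        show "inj_on \<sigma> {\<omega> \<in> ?T. ?X \<omega> = ?X \<omega>1}"
        proof (rule inj_onI)
          fix \<omega> \<omega>' assume "\<omega> \<in> {\<omega> \<in> ?T. ?X \<omega> = ?X \<omega>1}" "\<omega>' \<in> {\<omega> \<in> ?T. ?X \<omega> = ?X \<omega>1}"
            and s: "\<sigma> \<omega> = \<sigma> \<omega>'"
          then obtain M U M' U' where o: "\<omega> = (M, U, k, r)" "\<omega>' = (M', U', k, r)"
            and F: "M \<in> ?files" "M' \<in> ?files" and U: "U \<in> carrier_vec y" "U' \<in> carrier_vec y"
            and X: "restrict M ({..<f} - {k}) = restrict M' ({..<f} - {k})"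
            by auto
          have "swap M = swap M'" using s by (simp add: o \<sigma>_def)
          then have "M k = M' k" unfolding swap_def by (metis fun_upd_same)
          moreover have "M j = M' j" if "j < f" "j \<noteq> k" for j
            using fun_cong[OF X, of j] that by simp
          ultimately have MM: "M = M'" using F by (intro PiE_ext) auto
          let ?a = "dec r *\<^sub>v ?c M" and ?b = "dec r *\<^sub>v ?c (swap M)"
          have eq: "(?a + U) - ?b = (?a + U') - ?b" using s by (simp add: o \<sigma>_def MM)
          have "U = U'" by (rule vec_masked_cancel[OF dv dv U eq])
          then show "\<omega> = \<omega>'" using o MM by simp
        qed
        fix \<omega> assume "\<omega> \<in> ?T" "?X \<omega> = ?X \<omega>1"
        then obtain M U where o: "\<omega> = (M, U, k, r)" and F: "M \<in> ?files" and U: "U \<in> carrier_vec y"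
          by auto
        let ?U = "(dec r *\<^sub>v ?c M + U) - dec r *\<^sub>v ?c (swap M)"
        have U': "?U \<in> carrier_vec y" using dv U by (intro minus_carrier_vec add_carrier_vec)
        show "\<sigma> \<omega> \<in> ?T" using swap[OF F] U' by (simp add: o \<sigma>_def)
        show "?X (\<sigma> \<omega>) = ?X \<omega>2" by (auto simp: o \<sigma>_def \<omega> swap_def restrict_def fun_eq_iff)
        have "dec r *\<^sub>v ?c (swap M) + ?U = dec r *\<^sub>v ?c M + U"
          by (rule vec_add_diff_cancel[OF dv add_carrier_vec[OF dv U]])
        moreover have "swap M k = M k" by (simp add: swap_def)
        ultimately have "?reply k r (swap M) ?U = ?reply k r M U"
          by (simp only: reply[OF k r F U] reply[OF k r swap[OF F] U'])
        then show "spir_answers ?P {..<n} (\<sigma> \<omega>) = spir_answers ?P {..<n} \<omega>"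
          using spir_answers_eq_iff[of f H z y Rs ?Q x "{..<n}" n k r ?U U \<tau> "swap M" M,
              OF f H Q Rs order_refl k r U' U]
          by (simp add: o \<sigma>_def)
      qed
    qed
    then show "mutual_info (spir_cond_space f ?P k r) (spir_answers ?P {..<n}) ?X = 0"
      by (rule mutual_info_commute_eq_0[OF unif, THEN iffD1])
  qed
  moreover have "spir_user_secret \<BB> f ?P"
    unfolding spir_user_secret_def
  proof
    fix B assume B: "B \<in> \<BB>"
    have Bn: "B \<subseteq> {..<n}" using sub B by blast
    let ?T = "?files \<times> (carrier_vec y :: 'a Matrix.vec set) \<times> {..<f} \<times> Rs"
    let ?X = "\<lambda>(M, U, K, R). K"
    have unif: "uniform_on (spir_space f ?P) ?T"
      by (rule uniform_on_spir_space[of f H z y Rs ?Q x n \<tau>, OF f H Q Rs])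
    show "mutual_info (spir_space f ?P) ?X (spir_queries ?P B) = 0"
    proof (rule mutual_info_eq_0I[OF unif])
      fix \<omega>1 \<omega>2 assume \<omega>: "\<omega>1 \<in> ?T" "\<omega>2 \<in> ?T"
      obtain k1 k2 where k: "?X \<omega>1 = k1" "?X \<omega>2 = k2" "k1 < f" "k2 < f"
        using \<omega> by (cases \<omega>1, cases \<omega>2) auto
      let ?E = "\<lambda>k c. col (block_unit_mat f x k :: 'a mat) c"
      have E: "?E k c \<in> carrier_vec x" if "c < f * x" for k c
        using that by (simp add: carrier_vecI block_unit_mat_def)
      \<comment> \<open>Column \<open>c\<close> of a query is the share vector of column
        \<open>c\<close> of \<open>block_unit_mat\<close> with column \<open>c\<close> of
        \<open>R\<close> as seed. Thus user secrecy is privacy of \<open>f * x\<close> parallel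
        sharings, with one seed shift needed per column.\<close>
      define v where "v c = (SOME u. u \<in> carrier_vec y \<and>
        (\<forall>i\<in>positions z \<tau> B. (G *\<^sub>v ((?E k2 c - ?E k1 c) @\<^sub>v u)) $ i = 0))" for c
      have v: "v c \<in> carrier_vec y \<and>
        (\<forall>i\<in>positions z \<tau> B. (G *\<^sub>v ((?E k2 c - ?E k1 c) @\<^sub>v v c)) $ i = 0)" if c: "c < f * x" for c
      proof -
        have "?E k2 c - ?E k1 c \<in> carrier_vec x" using E[OF c] by auto
        then have "\<exists>u. u \<in> carrier_vec y \<and>
          (\<forall>i\<in>positions z \<tau> B. (G *\<^sub>v ((?E k2 c - ?E k1 c) @\<^sub>v u)) $ i = 0)"
          using G B unfolding sharing_matrix_def by blast
        then show ?thesis unfolding v_def by (rule someI_ex)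
      qed
      \<comment> \<open>Collects the column shifts: adding \<open>V\<close> to \<open>R\<close>
        compensates on the rows of \<open>B\<close> for changing the desired file from
        \<open>k1\<close> to \<open>k2\<close>.\<close>
      define V where "V = Matrix.mat y (f * x) (\<lambda>(i, c). v c $ i)"
      have V: "V \<in> carrier_mat y (f * x)" by (simp add: V_def)
      have colV: "col V c = v c" if "c < f * x" for c
        using v[OF that] that by (intro eq_vecI) (auto simp: V_def)
      define enc where "enc = the_inv_into Rs dec"
      have enc: "dec (enc R) = R" "enc R \<in> Rs" if "R \<in> carrier_mat y (f * x)" for R
        using dec that f_the_inv_into_f_bij_betw[OF dec, of R] the_inv_into_into[of dec Rs R Rs]
        by (auto simp: enc_def bij_betw_def)
      define \<sigma> where "\<sigma> = (\<lambda>(M :: nat \<Rightarrow> 'a Matrix.vec, U :: 'a Matrix.vec, K :: nat, r). (M, U, k2, enc (dec r + V)))"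
      have decV: "dec r + V \<in> carrier_mat y (f * x)" if "r \<in> Rs" for r
        using deccarr[OF that] V by auto
      have entry: "?Q k r $$ (i, c) = (G *\<^sub>v (?E k c @\<^sub>v col (dec r) c)) $ i"
        if "r \<in> Rs" "i < z" "c < f * x" for k r i c
      proof -
        have "col (dec r) c \<in> carrier_vec y" using deccarr[OF that(1)] that(3) by auto
        then have "(G *\<^sub>v (?E k c @\<^sub>v col (dec r) c)) $ i = (J *\<^sub>v ?E k c + H *\<^sub>v col (dec r) c) $ i"
          using JH E[OF that(3)] by simp
        also have "\<dots> = ?Q k r $$ (i, c)"
          using J H deccarr[OF that(1)] that carrier_matD[OF block_unit_mat_carrier[of f x k, where 'a = 'a]]
          by simp
        finally show ?thesis ..
      qed
      have row_eq: "row (?Q k2 (enc (dec r + V))) i = row (?Q k1 r) i"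
        if r: "r \<in> Rs" and i: "i \<in> positions z \<tau> B" for r i
      proof (rule eq_vecI)
        have iz: "i < z" using i by (simp add: positions_def)
        have eR: "enc (dec r + V) \<in> Rs" "dec (enc (dec r + V)) = dec r + V" using enc decV[OF r] by auto
        show "dim_vec (row (?Q k2 (enc (dec r + V))) i) = dim_vec (row (?Q k1 r) i)"
          using carrier_matD(2)[OF Q[OF k(3) r]] carrier_matD(2)[OF Q[OF k(4) eR(1)]]
          by (simp only: row_def dim_vec)
        fix c assume "c < dim_vec (row (?Q k1 r) i)"
        then have c: "c < f * x" using carrier_matD(2)[OF Q[OF k(3) r]] by (simp only: row_def dim_vec)
        have dc: "col (dec r) c \<in> carrier_vec y" using deccarr[OF r] c by auto
        have "(?E k2 c @\<^sub>v (col (dec r) c + v c)) - (?E k1 c @\<^sub>v col (dec r) c) = (?E k2 c - ?E k1 c) @\<^sub>v v c"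
          using E[OF c] dc v[OF c] by (intro append_vec_add_diff) auto
        then have "G *\<^sub>v ((?E k2 c - ?E k1 c) @\<^sub>v v c)
            = G *\<^sub>v (?E k2 c @\<^sub>v (col (dec r) c + v c)) - G *\<^sub>v (?E k1 c @\<^sub>v col (dec r) c)"
          using E[OF c] dc v[OF c] by (subst mult_minus_distrib_mat_vec[OF Gc, symmetric]) auto
        moreover have "(G *\<^sub>v ((?E k2 c - ?E k1 c) @\<^sub>v v c)) $ i = 0" using v[OF c] i by blast
        ultimately have "(G *\<^sub>v (?E k2 c @\<^sub>v (col (dec r) c + v c))) $ i = (G *\<^sub>v (?E k1 c @\<^sub>v col (dec r) c)) $ i"
          using iz Gc by simp
        moreover have "col (dec r + V) c = col (dec r) c + v c"
          using deccarr[OF r] V c colV[OF c] by (metis col_add)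
        ultimately have "?Q k2 (enc (dec r + V)) $$ (i, c) = ?Q k1 r $$ (i, c)"
          using entry[OF eR(1) iz c, of k2] entry[OF r iz c, of k1] eR(2) by simp
        then show "row (?Q k2 (enc (dec r + V))) i $ c = row (?Q k1 r) i $ c"
          using carrier_matD[OF Q[OF k(3) r]] carrier_matD[OF Q[OF k(4) eR(1)]] iz c
          by (simp only: index_row)
      qed
      show "\<exists>\<sigma>. inj_on \<sigma> {\<omega> \<in> ?T. ?X \<omega> = ?X \<omega>1} \<and>
        (\<forall>\<omega>\<in>?T. ?X \<omega> = ?X \<omega>1 \<longrightarrow> \<sigma> \<omega> \<in> ?T \<and> ?X (\<sigma> \<omega>) = ?X \<omega>2 \<and>
          spir_queries ?P B (\<sigma> \<omega>) = spir_queries ?P B \<omega>)"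
        unfolding k(1,2)
      proof (intro exI[of _ \<sigma>] conjI ballI impI)
        \<comment> \<open>On the fibre \<open>K\<close> is constantly \<open>k1\<close>, so
          overwriting it loses nothing; on labels the map is a translation by \<open>V\<close>
          carried through the bijection \<open>dec\<close>.\<close>
        show "inj_on \<sigma> {\<omega> \<in> ?T. ?X \<omega> = k1}"
        proof (rule inj_onI)
          fix \<omega> \<omega>' assume "\<omega> \<in> {\<omega> \<in> ?T. ?X \<omega> = k1}" "\<omega>' \<in> {\<omega> \<in> ?T. ?X \<omega> = k1}" and s: "\<sigma> \<omega> = \<sigma> \<omega>'"
          then obtain M U r M' U' r' where o: "\<omega> = (M, U, k1, r)" "\<omega>' = (M', U', k1, r')"
            and r: "r \<in> Rs" "r' \<in> Rs" by auto
          have "enc (dec r + V) = enc (dec r' + V)" using s by (simp add: o \<sigma>_def)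
          then have eq: "dec r + V = dec r' + V" using enc(1) decV r by metis
          have "dec r = dec r'"
          proof (rule eq_matI)
            fix i j assume "i < dim_row (dec r')" "j < dim_col (dec r')"
            then have ij: "i < y" "j < f * x" using deccarr[OF r(2)] by auto
            have "(dec r + V) $$ (i, j) = (dec r' + V) $$ (i, j)" using eq by simp
            then show "dec r $$ (i, j) = dec r' $$ (i, j)"
              using ij V deccarr[OF r(1)] deccarr[OF r(2)] by simp
          qed (use deccarr[OF r(1)] deccarr[OF r(2)] in auto)
          then have "r = r'" using dec r by (auto simp: bij_betw_def inj_on_def)
          then show "\<omega> = \<omega>'" using s by (simp add: o \<sigma>_def)
        qed
        fix \<omega> assume "\<omega> \<in> ?T" "?X \<omega> = k1"
        then obtain M U r where o: "\<omega> = (M, U, k1, r)" and F: "M \<in> ?files" and U: "U \<in> carrier_vec y"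
          and r: "r \<in> Rs" by auto
        have er: "enc (dec r + V) \<in> Rs" using enc decV[OF r] by blast
        show "\<sigma> \<omega> \<in> ?T" using F U k er by (simp add: o \<sigma>_def)
        show "?X (\<sigma> \<omega>) = k2" by (simp add: o \<sigma>_def)
        show "spir_queries ?P B (\<sigma> \<omega>) = spir_queries ?P B \<omega>"
          using spir_queries_eq_iff[of f H z y Rs ?Q x B n k2 "enc (dec r + V)" k1 r \<tau> M U M U,
              OF f H Q Rs Bn k(4) er k(3) r] row_eq[OF r]
          by (simp add: o \<sigma>_def)
      qed
    qed
  qed
  ultimately show ?thesis unfolding csspir_def by blast
qed

theorem corollary5:
  fixes n x y z :: nat
    and \<AA> \<BB> :: "nat set set"
    and \<tau> :: "nat \<Rightarrow> nat"
  assumes "n \<ge> 2"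
    and "access_structure n \<AA> \<BB>"
    and "\<AA> \<noteq> {}"
    and "x \<ge> 1" and "y \<ge> 1" and "z \<ge> 1"
    and "\<tau> \<in> {..<z} \<rightarrow> {..<n}"
  shows "let
      a = (\<exists>f\<ge>2. \<exists>P :: ('a::{field,finite} Matrix.vec, 'a Matrix.vec, nat,
                          'a Matrix.vec, 'a mat, 'a Matrix.vec) spir.
             linear_spir n f x y z \<tau> P \<and> csspir \<AA> \<BB> n f P \<and>
             pir_rate n P = real x / real z \<and> shared_randomness_rate P = real y / real x);
      b = (\<exists>P :: ('a Matrix.vec, 'a Matrix.vec, 'a Matrix.vec) nss.
             linear_nss n x y z \<tau> P \<and> csnss \<AA> \<BB> n P \<and>
             ss_rate n P = real x / real z \<and> nss_randomness_rate P = real y / real x);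
      c = (\<exists>G :: 'a mat. mmsp \<AA> \<BB> x y z G \<tau>);
      d = (\<forall>f\<ge>2. \<exists>P :: ('a Matrix.vec, 'a Matrix.vec, 'a mat,
                          'a Matrix.vec, 'a mat, 'a Matrix.vec) spir.
             projected_linear_spir n f x y z \<tau> P \<and> csspir \<AA> \<BB> n f P \<and>
             pir_rate n P = real x / real z \<and> shared_randomness_rate P = real y / real x)
    in (a \<longleftrightarrow> b) \<and> (b \<longleftrightarrow> c) \<and> (c \<longleftrightarrow> d)"
proof -
  note acc = assms(2) and x = assms(4) and \<tau> = assms(7)
  let ?share = "\<exists>G :: 'a mat. sharing_matrix \<AA> \<BB> x y z G \<tau>"
  define a where "a = (\<exists>f\<ge>2. \<exists>P :: ('a Matrix.vec, 'a Matrix.vec, nat,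
                          'a Matrix.vec, 'a mat, 'a Matrix.vec) spir.
             linear_spir n f x y z \<tau> P \<and> csspir \<AA> \<BB> n f P \<and>
             pir_rate n P = real x / real z \<and> shared_randomness_rate P = real y / real x)"
  define b where "b = (\<exists>P :: ('a Matrix.vec, 'a Matrix.vec, 'a Matrix.vec) nss.
             linear_nss n x y z \<tau> P \<and> csnss \<AA> \<BB> n P \<and>
             ss_rate n P = real x / real z \<and> nss_randomness_rate P = real y / real x)"
  define c where "c = (\<exists>G :: 'a mat. mmsp \<AA> \<BB> x y z G \<tau>)"
  define d where "d = (\<forall>f\<ge>2. \<exists>P :: ('a Matrix.vec, 'a Matrix.vec, 'a mat,
                          'a Matrix.vec, 'a mat, 'a Matrix.vec) spir.
             projected_linear_spir n f x y z \<tau> P \<and> csspir \<AA> \<BB> n f P \<and>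
             pir_rate n P = real x / real z \<and> shared_randomness_rate P = real y / real x)"
  have a: "a \<longleftrightarrow> ?share"
  proof
    assume a
    then obtain f and P :: "('a Matrix.vec, 'a Matrix.vec, nat, 'a Matrix.vec, 'a mat, 'a Matrix.vec) spir"
      where f: "f \<ge> 2" and P: "linear_spir n f x y z \<tau> P" "csspir \<AA> \<BB> n f P"
      unfolding a_def by blast
    from P(1) obtain H Rs Q where H: "H \<in> carrier_mat z y"
      and Q: "\<forall>k<f. \<forall>r\<in>Rs. Q k r \<in> carrier_mat z (f * x)"
      and eq: "P = linear_spir_protocol n f x y z \<tau> H Rs Q"
      unfolding linear_spir_def by blast
    show ?share
      by (rule csspir_imp_sharing_matrix[OF acc assms(3) \<tau> x f H Q P(2)[unfolded eq]])
  next
    assume ?share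
    then obtain G :: "'a mat" where G: "sharing_matrix \<AA> \<BB> x y z G \<tau>" by blast
    \<comment> \<open>Condition (a) takes natural numbers as user randomness, so the finitely many
      matrices are enumerated; \<open>f = 2\<close> is a sufficient choice.\<close>
    obtain dec where dec: "bij_betw dec {0..<card (carrier_mat y (2 * x) :: 'a mat set)} (carrier_mat y (2 * x) :: 'a mat set)"
      using ex_bij_betw_nat_finite[OF finite_carrier_mat] by blast
    define J where "J = Matrix.mat z x (\<lambda>(i, j). G $$ (i, j))"
    define H where "H = Matrix.mat z y (\<lambda>(i, j). G $$ (i, x + j))"
    let ?Rs = "{0..<card (carrier_mat y (2 * x) :: 'a mat set)}"
    let ?Q = "\<lambda>k r. J * block_unit_mat 2 x k + H * dec r"
    let ?P = "linear_spir_protocol n 2 x y z \<tau> H ?Rs ?Q"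
    have "csspir \<AA> \<BB> n 2 ?P"
      unfolding J_def H_def by (rule sharing_matrix_imp_csspir[OF acc _ G dec]) simp
    moreover have "linear_spir n 2 x y z \<tau> ?P"
    proof -
      have Hc: "H \<in> carrier_mat z y" by (simp add: H_def)
      have Qc: "?Q k r \<in> carrier_mat z (2 * x)" if "r \<in> ?Rs" for k r
      proof -
        have "dec r \<in> carrier_mat y (2 * x)" using dec that by (auto simp: bij_betw_def)
        then show ?thesis
          by (intro add_carrier_mat mult_carrier_mat[of _ _ y]) (simp_all add: H_def)
      qed
      show ?thesis
        unfolding linear_spir_def
        by (intro exI[of _ H] exI[of _ ?Rs] exI[of _ ?Q] conjI allI impI ballI refl Hc Qc)
    qed
    ultimately show a
      unfolding a_def by (intro exI[of _ 2] exI[of _ ?P] conjI spir_rates[OF \<tau>] order_refl)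
  qed
  have b: "b \<longleftrightarrow> ?share"
  proof
    assume b
    then obtain P :: "('a Matrix.vec, 'a Matrix.vec, 'a Matrix.vec) nss"
      where P: "linear_nss n x y z \<tau> P" "csnss \<AA> \<BB> n P" unfolding b_def by blast
    from P(1) obtain \<psi> :: "'a Matrix.vec \<Rightarrow> 'a Matrix.vec"
      where lin: "linear_map class_ring (module_vec TYPE('a) (x + y)) (module_vec TYPE('a) z) \<psi>"
      and eq: "P = matrix_nss n x y z \<tau> \<psi>"
      unfolding linear_nss_def matrix_nss_def by blast
    obtain G where G: "G \<in> carrier_mat z (x + y)" "\<And>v. v \<in> carrier_vec (x + y) \<Longrightarrow> \<psi> v = G *\<^sub>v v"
      using linear_map_module_vec_eq_mult_mat_vec[OF lin] by blast
    then show ?share using csnss_matrix_nss_iff[OF acc G] P(2) eq by blast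
  next
    assume ?share
    then obtain G :: "'a mat" where G: "sharing_matrix \<AA> \<BB> x y z G \<tau>" by blast
    then have Gc: "G \<in> carrier_mat z (x + y)" by (simp add: sharing_matrix_def)
    let ?P = "matrix_nss n x y z \<tau> (\<lambda>v. G *\<^sub>v v)"
    have "csnss \<AA> \<BB> n ?P" using csnss_matrix_nss_iff[OF acc Gc refl] G by blast
    moreover have "linear_nss n x y z \<tau> ?P"
      unfolding linear_nss_def matrix_nss_def using linear_map_mult_mat_vec[OF Gc] by blast
    ultimately show b unfolding b_def by (intro exI[of _ ?P] conjI nss_rates[OF \<tau>])
  qed
  have c: "c \<longleftrightarrow> ?share" unfolding c_def mmsp_iff_sharing_matrix ..
  have d: "d \<longleftrightarrow> ?share"
  proof
    assume d
    \<comment> \<open>The instance with two files already contains the second file needed to recover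
      a sharing matrix.\<close>
    then obtain P :: "('a Matrix.vec, 'a Matrix.vec, 'a mat, 'a Matrix.vec, 'a mat, 'a Matrix.vec) spir"
      where P: "projected_linear_spir n 2 x y z \<tau> P" "csspir \<AA> \<BB> n 2 P"
      unfolding d_def by blast
    from P(1) obtain H J where H: "H \<in> carrier_mat z y" and J: "J \<in> carrier_mat z x"
      and eq: "P = linear_spir_protocol n 2 x y z \<tau> H (carrier_mat y (2 * x))
        (\<lambda>k R. J * block_unit_mat 2 x k + H * R)"
      unfolding projected_linear_spir_def by blast
    have "\<forall>k<2. \<forall>R\<in>carrier_mat y (2 * x). J * block_unit_mat 2 x k + H * R \<in> carrier_mat z (2 * x)"
      using H J by (intro allI ballI impI add_carrier_mat mult_carrier_mat[of _ _ y])
    then show ?share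
      by (rule csspir_imp_sharing_matrix[OF acc assms(3) \<tau> x order_refl H _ P(2)[unfolded eq]])
  next
    assume ?share
    then obtain G :: "'a mat" where G: "sharing_matrix \<AA> \<BB> x y z G \<tau>" by blast
    define J where "J = Matrix.mat z x (\<lambda>(i, j). G $$ (i, j))"
    define H where "H = Matrix.mat z y (\<lambda>(i, j). G $$ (i, x + j))"
    show d
      unfolding d_def
    proof (intro allI impI)
      fix f :: nat assume f: "f \<ge> 2"
      let ?P = "linear_spir_protocol n f x y z \<tau> H (carrier_mat y (f * x))
        (\<lambda>k R. J * block_unit_mat f x k + H * R)"
      have "csspir \<AA> \<BB> n f ?P"
        using sharing_matrix_imp_csspir[where dec = "\<lambda>R. R", OF acc _ G] f
        unfolding J_def H_def by (simp add: bij_betw_def)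
      moreover have "projected_linear_spir n f x y z \<tau> ?P"
        unfolding projected_linear_spir_def
        by (intro exI[of _ H] exI[of _ J]) (simp add: H_def J_def)
      ultimately show "\<exists>P :: ('a Matrix.vec, 'a Matrix.vec, 'a mat,
                          'a Matrix.vec, 'a mat, 'a Matrix.vec) spir.
             projected_linear_spir n f x y z \<tau> P \<and> csspir \<AA> \<BB> n f P \<and>
             pir_rate n P = real x / real z \<and> shared_randomness_rate P = real y / real x"
        by (intro exI[of _ ?P] conjI spir_rates[OF \<tau>])
    qed
  qed
  show ?thesis
    unfolding Let_def a_def[symmetric] b_def[symmetric] c_def[symmetric] d_def[symmetric]
    by (simp only: a b c d)
qed

end
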